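(* There is an absolute constant $C>0$ such that the following holds. Let $N\in\mathbb{N}$, let $X \subseteq \mathbb{R}^N$ be a set with at least two points, and let $\varepsilon \in (0,1)$. Then there exist $m\in\mathbb{N}$ with $m \le C\,\varepsilon^{-2}\, w(S_X)^2$ (that is, $m=\mathcal{O}(\varepsilon^{-2} w(S_X)^2)$) and a function $f \colon \mathbb{R}^N \to \mathbb{R}^{m}$ such that $$(1-\varepsilon)\|x-y\|_2 \leq \|f(x)-f(y)\|_2 \leq (1+\varepsilon)\|x-y\|_2 \quad \text{for all } x \in X \text{ and all } y \in \mathbb{R}^N.$$
   Context: $\|\cdot\|_2$ is the Euclidean norm. For $X\subseteq\mathbb{R}^N$, the set of unit secants of $X$ is $$S_X := \overline{\left\{ \frac{x-y}{\|x-y\|_2} : x,y\in X,\ x \neq y \right\}},$$ where the bar denotes closure in $\mathbb{R}^N$. The Gaussian width of a set $A\subseteq\mathbb{R}^N$ is $w(A) := \mathbb{E}\sup_{a\in A}\langle g,a\rangle$, where $g$ is a random vector in $\mathbb{R}^N$ with $N$ independent standard normal entries. *)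

theory Defs
  imports "HOL-Probability.Probability"
begin

text \<open>
  The dimensions \<open>N\<close> and \<open>m\<close> are quantified inside the theorem (below the absolute constant), so
  \<open>\<real>\<^sup>N\<close> is the carrier of the library's \<^const>\<open>Euclidean_space\<close> \<open>N\<close>: functions
  \<open>nat \<Rightarrow> real\<close> with topology of coordinatewise convergence, vanishing from index \<open>N\<close> on.
\<close>

abbreviation Rvec :: "nat \<Rightarrow> (nat \<Rightarrow> real) set" where
  "Rvec N \<equiv> topspace (Euclidean_space N)"

abbreviation norm2 :: "nat \<Rightarrow> (nat \<Rightarrow> real) \<Rightarrow> real" where
  "norm2 N x \<equiv> L2_set x {..<N}"

abbreviation inner_prod :: "nat \<Rightarrow> (nat \<Rightarrow> real) \<Rightarrow> (nat \<Rightarrow> real) \<Rightarrow> real" where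
  "inner_prod N x y \<equiv> (\<Sum>i<N. x i * y i)"

definition unit_secants :: "nat \<Rightarrow> (nat \<Rightarrow> real) set \<Rightarrow> (nat \<Rightarrow> real) set" where
  "unit_secants N X =
     Euclidean_space N closure_of
       {(\<lambda>i. (x i - y i) / norm2 N (x - y)) | x y. x \<in> X \<and> y \<in> X \<and> x \<noteq> y}"

text \<open>
  Law of a vector with \<open>N\<close> independent standard normal entries. Sample points of the product
  measure are \<^const>\<open>undefined\<close> (rather than 0) from index \<open>N\<close> on; \<open>inner_prod N\<close> ignores these.
\<close>

definition std_gaussian :: "nat \<Rightarrow> (nat \<Rightarrow> real) measure" where
  "std_gaussian N = (\<Pi>\<^sub>M i\<in>{..<N}. density lborel std_normal_density)"

text \<open>
  Real-valued, hence meaningful for bounded nonempty \<open>A\<close>, where the supremum is finite and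
  integrable. The sets of unit secants of sets with at least two points are of this kind.
\<close>

definition gaussian_width :: "nat \<Rightarrow> (nat \<Rightarrow> real) set \<Rightarrow> real" where
  "gaussian_width N A = (LINT g|std_gaussian N. (SUP a\<in>A. inner_prod N g a))"

end

theory Submission
  imports Defs "HOL-Real_Asymp.Real_Asymp"
begin

text \<open>
  Let \<open>S\<close> be the set of unit secants, \<open>W h\<close> the supremum of \<open>\<langle>h, s\<rangle>\<close> over \<open>s \<in> S\<close>, and \<open>w\<close> its
  Gaussian mean, the width of \<open>S\<close>. The embedding is a random linear map followed by a non-linear
  extension to the points outside \<open>X\<close>.

  Linear part. Let \<open>T\<close> consist of all \<open>v\<close> with \<open>\<parallel>v\<parallel> \<le> 1\<close> and \<open>\<bar>\<langle>h, v\<rangle>\<bar> \<le> W h\<close> for all \<open>h\<close>; as \<open>S\<close> is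
  symmetric, \<open>T\<close> contains its convex hull. With positive probability a Gaussian \<open>m \<times> N\<close> matrix
  \<open>G\<close> satisfies \<open>\<bar>\<parallel>G v\<parallel> - sqrt m \<parallel>v\<parallel>\<bar> \<le> C w\<close> for all \<open>v \<in> T\<close> at once
  (\<open>gaussian_matrix_near_isometry\<close>). This rests on Gordon's comparison of \<open>\<parallel>G v\<parallel> + \<parallel>v\<parallel> \<gamma>\<close> with
  \<open>\<parallel>v\<parallel> \<parallel>g\<parallel> + \<langle>h, v\<rangle>\<close>, where \<open>g\<close>, \<open>h\<close> and \<open>\<gamma>\<close> are independent Gaussian vectors in dimensions
  \<open>m\<close>, \<open>N\<close> and \<open>1\<close>: the second family stays uniformly close to \<open>sqrt m \<parallel>v\<parallel>\<close>, because its deviation is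
  at most \<open>\<bar>\<parallel>g\<parallel> - sqrt m\<bar> + W h\<close>. The comparison is proved by rotating one set of Gaussian variables
  into the other (\<open>gaussian_interpolation\<close>); by Stein's identity the derivative along the rotation is
  a difference of partial Laplacians, which has a sign for a smooth substitute of the event that all
  members of the family exceed given levels (\<open>sign\<close>, \<open>gordon_comparison\<close>). Both the upper and the
  lower bound for \<open>\<parallel>G v\<parallel>\<close> come from the same computation, with a sign \<open>\<sigma> = \<plusminus>1\<close> in front of the norm.
  Since \<open>w \<ge> 1/2\<close>, the matrix \<open>A = G / sqrt m\<close> has \<open>\<bar>\<parallel>A v\<parallel> - \<parallel>v\<parallel>\<bar> \<le> \<delta>\<close> on \<open>T\<close> as soon as \<open>m\<close> is a
  constant multiple of \<open>(w / \<delta>)\<^sup>2\<close>.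

  Extension. On \<open>X\<close> the map is \<open>A\<close>. For another point \<open>y\<close> pick \<open>x0 \<in> X\<close> whose distance \<open>a\<close> to \<open>y\<close> is
  at most twice that of any point of \<open>X\<close>, and put \<open>y - x0 = a u\<close>. Convex duality gives a vector \<open>u'\<close> of
  length at most \<open>1\<close> with \<open>\<langle>u', A z\<rangle>\<close> equal to \<open>\<langle>u, z\<rangle>\<close> up to \<open>2 \<delta> \<parallel>z\<parallel>\<close> for all differences
  \<open>z\<close> of points of \<open>X\<close> (\<open>near_isometry_dual_vector\<close>). This step needs the lower
  bound on \<open>\<parallel>A v\<parallel>\<close> on the convex hull of \<open>S\<close> and not only on \<open>S\<close>. The image of \<open>y\<close> is \<open>A x0 + a u'\<close>, with one more coordinate that brings the
  distance to \<open>A x0\<close> up to \<open>a\<close>; expanding squares shows that all squared distances to \<open>X\<close> are right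
  up to a factor \<open>1 \<plusminus> 51 \<delta>\<close> (\<open>terminal_point_near\<close>). If there is no such \<open>x0\<close>, then \<open>y\<close> is a limit of
  points of \<open>X\<close> and \<open>A y\<close> is a suitable image.
\<close>

section \<open>Norms and inner products on coordinate vectors\<close>

lemma norm2_sq: "(norm2 n x)\<^sup>2 = (\<Sum>i<n. (x i)\<^sup>2)"
  by (simp add: L2_set_def sum_nonneg)

lemma norm2_scale: "norm2 n (\<lambda>i. s * x i) = \<bar>s\<bar> * norm2 n x"
  by (simp add: L2_set_def power_mult_distrib sum_distrib_left[symmetric] real_sqrt_mult)

lemma norm2_add_sq:
  "(norm2 n (\<lambda>i. x i + s * y i))\<^sup>2 = (norm2 n x)\<^sup>2 + 2 * s * inner_prod n x y + s\<^sup>2 * (norm2 n y)\<^sup>2"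
  unfolding norm2_sq sum_distrib_left sum.distrib[symmetric]
  by (intro sum.cong) (auto simp: power2_eq_square algebra_simps)

lemma inner_prod_scale: "inner_prod n x (\<lambda>i. s * y i) = s * inner_prod n x y"
  "inner_prod n (\<lambda>i. s * x i) y = s * inner_prod n x y"
  by (auto simp: sum_distrib_left mult_ac)

lemma inner_prod_add: "inner_prod n x (\<lambda>i. y i + z i) = inner_prod n x y + inner_prod n x z"
  by (simp add: distrib_left sum.distrib)

lemma norm2_Cauchy_Schwarz: "\<bar>inner_prod n x y\<bar> \<le> norm2 n x * norm2 n y"
proof -
  have "\<bar>inner_prod n x y\<bar> \<le> (\<Sum>i<n. \<bar>x i\<bar> * \<bar>y i\<bar>)"
    by (rule order_trans[OF sum_abs]) (simp add: abs_mult)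
  also have "\<dots> \<le> norm2 n x * norm2 n y" by (rule L2_set_mult_ineq)
  finally show ?thesis .
qed

lemma norm2_diff_sq:
  "(norm2 n (\<lambda>i. x i - y i))\<^sup>2 = (norm2 n x)\<^sup>2 - 2 * inner_prod n x y + (norm2 n y)\<^sup>2"
  using norm2_add_sq[of x "- 1" y n] by simp

lemma norm2_commute: "norm2 n (x - y) = norm2 n (y - x)"
  by (simp add: L2_set_def power2_commute)

lemma norm2_triangle: "norm2 n (x - z) \<le> norm2 n (x - y) + norm2 n (y - z)"
  using L2_set_triangle_ineq[of "x - y" "y - z" "{..<n}"] by (simp add: fun_diff_def)

lemma norm2_Suc_sq: "(norm2 (m + 1) q)\<^sup>2 = (norm2 m q)\<^sup>2 + (q m)\<^sup>2"
  unfolding norm2_sq by simp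

lemma norm2_cong: "(\<And>i. i < n \<Longrightarrow> x i = y i) \<Longrightarrow> norm2 n x = norm2 n y"
  by (rule L2_set_cong) auto


section \<open>Gaussian vectors with a finite index set\<close>

text \<open>
  Arbitrary index sets are allowed because the comparison argument handles a matrix, two vectors and
  a scalar as one Gaussian vector indexed by pairs.
\<close>

definition std_gaussian_on :: "'k set \<Rightarrow> ('k \<Rightarrow> real) measure" where
  "std_gaussian_on K = (\<Pi>\<^sub>M k\<in>K. std_normal_distribution)"

lemma prob_space_std_normal: "prob_space std_normal_distribution"
  by (rule prob_space_normal_density) simp

lemma product_prob_space_std_normal: "product_prob_space (\<lambda>_::'k. std_normal_distribution)"
  by (intro product_prob_spaceI prob_space_std_normal)

lemma prob_space_std_gaussian_on: "prob_space (std_gaussian_on K)"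
  unfolding std_gaussian_on_def by (intro prob_space_PiM prob_space_std_normal)

lemma std_gaussian_on_component:
  "k \<in> K \<Longrightarrow> (\<lambda>\<xi>. \<xi> k) \<in> borel_measurable (std_gaussian_on K)"
  unfolding std_gaussian_on_def
  using measurable_component_singleton[of k K "\<lambda>_. std_normal_distribution"]
  by (simp cong: measurable_cong_sets)

lemma integrable_bounded:
  assumes "f \<in> borel_measurable (std_gaussian_on K)" "\<And>x. \<bar>f x\<bar> \<le> B"
  shows "integrable (std_gaussian_on K) (f :: _ \<Rightarrow> real)"
proof -
  interpret prob_space "std_gaussian_on K" by (rule prob_space_std_gaussian_on)
  show ?thesis using assms by (intro integrable_const_bound[where B=B]) auto
qed

text \<open>
  Stein's identity: \<open>- y\<close> times the normal density \<open>\<phi>\<close> is the derivative of \<open>\<phi>\<close>, so the difference of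
  the two integrands is the derivative of \<open>- \<phi> q\<close>, which vanishes at both ends.
\<close>

lemma stein_std_normal:
  fixes q q' :: "real \<Rightarrow> real"
  assumes q: "\<And>y. (q has_real_derivative q' y) (at y)" and c: "\<And>y. isCont q' y"
    and B: "\<And>y. \<bar>q y\<bar> \<le> B" "\<And>y. \<bar>q' y\<bar> \<le> B"
  shows "(LINT y|std_normal_distribution. y * q y) = (LINT y|std_normal_distribution. q' y)"
proof -
  let ?d = std_normal_density
  have qc: "continuous_on UNIV q" using q DERIV_isCont continuous_at_imp_continuous_on by blast
  have q'c: "continuous_on UNIV q'" using c continuous_at_imp_continuous_on by blast
  have [measurable]: "q \<in> borel_measurable borel" "q' \<in> borel_measurable borel"
    using borel_measurable_continuous_onI[OF qc] borel_measurable_continuous_onI[OF q'c] .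
  have m1: "(\<lambda>y. ?d y * q' y) \<in> borel_measurable lborel" by measurable
  have m2: "(\<lambda>y. ?d y * (y * q y)) \<in> borel_measurable lborel" by measurable
  have i1: "integrable lborel (\<lambda>y. ?d y * q' y)"
  proof (rule Bochner_Integration.integrable_bound[where f="\<lambda>y. B * ?d y"])
    show "AE y in lborel. norm (?d y * q' y) \<le> norm (B * ?d y)"
    proof (intro AE_I2)
      fix y
      have "?d y * \<bar>q' y\<bar> \<le> ?d y * B" by (intro mult_left_mono B) auto
      also have "\<dots> \<le> \<bar>B * ?d y\<bar>" by (simp add: mult.commute)
      finally show "norm (?d y * q' y) \<le> norm (B * ?d y)" by (simp add: abs_mult)
    qed
    show "integrable lborel (\<lambda>y. B * ?d y)"
      by (intro integrable_mult_right integrable_normal_density) simp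
  qed measurable
  have i2: "integrable lborel (\<lambda>y. ?d y * (y * q y))"
  proof (rule Bochner_Integration.integrable_bound[where f="\<lambda>y. B * (?d y * \<bar>y\<bar> ^ 1)"])
    show "integrable lborel (\<lambda>y. B * (?d y * \<bar>y\<bar> ^ 1))"
      by (rule integrable_mult_right) (rule integrable_std_normal_moment_abs)
    show "AE y in lborel. norm (?d y * (y * q y)) \<le> norm (B * (?d y * \<bar>y\<bar> ^ 1))"
    proof (intro AE_I2)
      fix y
      have "?d y * \<bar>y\<bar> * \<bar>q y\<bar> \<le> ?d y * \<bar>y\<bar> * B" by (intro mult_left_mono B) auto
      also have "\<dots> \<le> \<bar>B * (?d y * \<bar>y\<bar>)\<bar>" by (simp add: mult.commute mult.left_commute)
      finally show "norm (?d y * (y * q y)) \<le> norm (B * (?d y * \<bar>y\<bar> ^ 1))"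
        by (simp add: abs_mult mult.assoc)
    qed
  qed (rule m2)
  define F where "F = (\<lambda>y. ?d y * q y)"
  define f where "f = (\<lambda>y. ?d y * q' y - ?d y * (y * q y))"
  \<comment> \<open>\<open>F\<close> is an antiderivative of \<open>f\<close>, the difference of the two integrands\<close>
  have dd: "(?d has_real_derivative (- y * ?d y)) (at y)" for y
    unfolding std_normal_density_def by (auto intro!: derivative_eq_intros simp: field_simps)
  have dF: "(F has_real_derivative f y) (at y)" for y
    unfolding F_def f_def by (rule derivative_eq_intros dd q)+ (simp add: algebra_simps)
  have lim: "(?d \<longlongrightarrow> 0) at_top" "(?d \<longlongrightarrow> 0) at_bot"
    unfolding std_normal_density_def by real_asymp+
  have bd: "\<bar>F y\<bar> \<le> B * ?d y" for y
    unfolding F_def using mult_left_mono[OF B(1)[of y], of "?d y"] by (simp add: abs_mult mult.commute)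
  have limF: "(F \<longlongrightarrow> 0) at_top" "(F \<longlongrightarrow> 0) at_bot"
    using bd by (auto intro!: Lim_null_comparison[of F "\<lambda>y. B * ?d y"] tendsto_mult_right_zero lim)
  have "(LBINT y=-\<infinity>..\<infinity>. f y) = 0 - 0"
  proof (rule interval_integral_FTC_integrable[where F=F])
    show "(F has_vector_derivative f x) (at x)" for x
      using dF by (simp add: has_real_derivative_iff_has_vector_derivative)
    show "isCont f x" for x
      unfolding f_def using q c dd by (intro continuous_intros) (auto intro: DERIV_isCont)
    show "set_integrable lborel (einterval (-\<infinity>) \<infinity>) f"
      unfolding f_def set_integrable_def using i1 i2 by simp
  qed (use limF in \<open>auto simp: ereal_tendsto_simps\<close>)
  then have "(LINT y|lborel. f y) = 0"
    by (simp add: interval_lebesgue_integral_def set_lebesgue_integral_def)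
  then have "(LINT y|lborel. ?d y * q' y) = (LINT y|lborel. ?d y * (y * q y))"
    unfolding f_def using i1 i2 by simp
  then show ?thesis by (simp add: integral_density)
qed

lemma distr_std_gaussian_on_component:
  "k \<in> K \<Longrightarrow> distr (std_gaussian_on K) std_normal_distribution (\<lambda>x. x k) = std_normal_distribution"
  unfolding std_gaussian_on_def
  by (rule distr_PiM_component[of K "\<lambda>_. std_normal_distribution"]) (auto intro: prob_space_std_normal)

lemma
  fixes g :: "real \<Rightarrow> real"
  assumes k: "k \<in> K" and g[measurable]: "g \<in> borel_measurable borel"
  shows integral_component:
      "(LINT x|std_gaussian_on K. g (x k)) = (LINT y|std_normal_distribution. g y)" (is ?A)
    and integrable_component:
      "integrable std_normal_distribution g \<Longrightarrow> integrable (std_gaussian_on K) (\<lambda>x. g (x k))" (is "_ \<Longrightarrow> ?B")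
proof -
  have m: "(\<lambda>x. x k) \<in> measurable (std_gaussian_on K) std_normal_distribution"
    using std_gaussian_on_component[OF k] by (simp cong: measurable_cong_sets)
  have g': "g \<in> borel_measurable std_normal_distribution" by simp
  show ?A
    using integral_distr[OF m g'] unfolding distr_std_gaussian_on_component[OF k] by simp
  show ?B if "integrable std_normal_distribution g"
    using integrable_distr[OF m] that unfolding distr_std_gaussian_on_component[OF k] by blast
qed

lemma
  shows integrable_std_normal_pow: "integrable std_normal_distribution (\<lambda>x. x ^ n)"
    and std_normal_mean: "(LINT y|std_normal_distribution. y) = 0"
    and std_normal_second_moment: "(LINT y|std_normal_distribution. y\<^sup>2) = 1"
    and std_normal_fourth_moment: "(LINT y|std_normal_distribution. y ^ 4) = 3"
proof -
  show "integrable std_normal_distribution (\<lambda>x. x ^ n)"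
    by (rule integrable_std_normal_distribution_moment)
  show "(LINT y|std_normal_distribution. y) = 0"
    using integral_std_normal_distribution_moment_odd[of 1] by simp
  show "(LINT y|std_normal_distribution. y\<^sup>2) = 1"
    using std_normal_distribution_even_moments(1)[of 1] by simp
  show "(LINT y|std_normal_distribution. y ^ 4) = 3"
    using std_normal_distribution_even_moments(1)[of 2] by (simp add: fact_numeral)
qed

lemma integrable_component_mult:
  assumes k: "k \<in> K" and f: "f \<in> borel_measurable (std_gaussian_on K)" "\<And>x. \<bar>f x\<bar> \<le> B"
  shows "integrable (std_gaussian_on K) (\<lambda>x. x k * f x)"
proof (rule Bochner_Integration.integrable_bound[where f="\<lambda>x. B * x k"])
  show "integrable (std_gaussian_on K) (\<lambda>x. B * x k)"
    by (rule integrable_mult_right, rule integrable_component[OF k, of "\<lambda>y. y"],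
        rule measurable_ident_sets[OF refl], rule integrable_std_normal_pow[of 1, unfolded power_one_right])
  show "AE x in std_gaussian_on K. norm (x k * f x) \<le> norm (B * x k)"
  proof (intro AE_I2)
    fix x :: "'a \<Rightarrow> real"
    have "\<bar>f x\<bar> * \<bar>x k\<bar> \<le> \<bar>B\<bar> * \<bar>x k\<bar>"
      by (intro mult_right_mono order_trans[OF f(2)[of x] abs_ge_self] abs_ge_zero)
    then show "norm (x k * f x) \<le> norm (B * x k)"
      unfolding real_norm_def abs_mult by (simp only: mult.commute)
  qed
qed (rule borel_measurable_times[OF std_gaussian_on_component[OF k] f(1)])

text \<open>
  Integrating out the coordinate \<open>k\<close> first reduces the identity to the one-dimensional one.
\<close>

lemma stein_std_gaussian_on:
  assumes K: "finite K" "k \<in> K"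
    and m: "Q \<in> borel_measurable (std_gaussian_on K)" "Q' \<in> borel_measurable (std_gaussian_on K)"
    and d: "\<And>x y. ((\<lambda>t. Q (x(k := t))) has_real_derivative Q' (x(k := y))) (at y)"
    and c: "\<And>x y. isCont (\<lambda>t. Q' (x(k := t))) y"
    and B: "\<And>x. \<bar>Q x\<bar> \<le> B" "\<And>x. \<bar>Q' x\<bar> \<le> B"
  shows "(LINT x|std_gaussian_on K. x k * Q x) = (LINT x|std_gaussian_on K. Q' x)"
proof -
  define I where "I = K - {k}"
  have I: "finite I" "k \<notin> I" "K = insert k I" using K by (auto simp: I_def)
  interpret product_prob_space "\<lambda>_. std_normal_distribution" "UNIV :: 'a set"
    by (rule product_prob_space_std_normal)
  have i1: "integrable (Pi\<^sub>M (insert k I) (\<lambda>_. std_normal_distribution)) (\<lambda>x. x k * Q x)"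
    using integrable_component_mult[OF K(2) m(1) B(1)] I(3) by (simp add: std_gaussian_on_def)
  have i2: "integrable (Pi\<^sub>M (insert k I) (\<lambda>_. std_normal_distribution)) Q'"
    using integrable_bounded[OF m(2) B(2)] I(3) by (simp add: std_gaussian_on_def)
  have "(LINT x|std_gaussian_on K. x k * Q x)
      = (LINT x|Pi\<^sub>M I (\<lambda>_. std_normal_distribution). LINT y|std_normal_distribution. y * Q (x(k := y)))"
    unfolding std_gaussian_on_def I(3) using product_integral_insert[OF I(1,2) i1] by simp
  also have "\<dots> = (LINT x|Pi\<^sub>M I (\<lambda>_. std_normal_distribution). LINT y|std_normal_distribution. Q' (x(k := y)))"
    by (intro Bochner_Integration.integral_cong refl stein_std_normal[where B=B] d c B)
  also have "\<dots> = (LINT x|std_gaussian_on K. Q' x)"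
    unfolding std_gaussian_on_def I(3) using product_integral_insert[OF I(1,2) i2] by simp
  finally show ?thesis .
qed

lemma integral_product_two_components:
  fixes a :: "real \<Rightarrow> real"
  assumes K: "finite K" "k \<in> K" "l \<in> K" "k \<noteq> l"
    and a: "integrable std_normal_distribution a" "(LINT y|std_normal_distribution. a y) = 0"
  shows "integrable (std_gaussian_on K) (\<lambda>x. a (x k) * a (x l))" (is ?A)
    and "(LINT x|std_gaussian_on K. a (x k) * a (x l)) = 0" (is ?B)
proof -
  interpret product_prob_space "\<lambda>_. std_normal_distribution" "UNIV :: 'a set"
    by (rule product_prob_space_std_normal)
  interpret N: prob_space std_normal_distribution by (rule prob_space_std_normal)
  \<comment> \<open>\<open>a (x k) * a (x l)\<close> as a product over all of \<open>K\<close>, to which the product formula applies\<close>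
  define f where "f i y = (if i = k then a y else 1) * (if i = l then a y else 1)" for i y
  have f: "f i = (if i = k \<or> i = l then a else (\<lambda>_. 1))" for i
    using K(4) by (auto simp: f_def)
  have fi: "integrable std_normal_distribution (f i)" for i
    using a(1) by (auto simp: f)
  have p: "(\<Prod>i\<in>K. f i (x i)) = a (x k) * a (x l)" for x
    unfolding f_def prod.distrib using K by (simp add: prod.delta)
  show ?A
    using product_integrable_prod[of K f, OF K(1) fi] unfolding p std_gaussian_on_def .
  have "(LINT x|std_gaussian_on K. a (x k) * a (x l)) = (\<Prod>i\<in>K. integral\<^sup>L std_normal_distribution (f i))"
    using product_integral_prod[of K f, OF K(1) fi] unfolding p std_gaussian_on_def .
  also have "\<dots> = 0"
    using K a(2) by (intro prod_zero[OF K(1)] bexI[of _ k]) (auto simp: f)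
  finally show ?B .
qed

text \<open>
  Distinct coordinates are independent, so the mixed terms of the square have mean zero. This is used
  for linear forms (\<open>a y = y\<close>) and for the fluctuation of a squared norm (\<open>a y = y\<^sup>2 - 1\<close>).
\<close>

lemma second_moment_of_centered_sum:
  fixes a :: "real \<Rightarrow> real" and c :: "'k \<Rightarrow> real"
  assumes K: "finite K" "J \<subseteq> K"
    and a: "integrable std_normal_distribution a" "(LINT y|std_normal_distribution. a y) = 0"
    and a2: "integrable std_normal_distribution (\<lambda>y. (a y)\<^sup>2)"
  shows "integrable (std_gaussian_on K) (\<lambda>x. (\<Sum>k\<in>J. c k * a (x k))\<^sup>2)" (is ?A)
    and "(LINT x|std_gaussian_on K. (\<Sum>k\<in>J. c k * a (x k))\<^sup>2)
       = (\<Sum>k\<in>J. (c k)\<^sup>2) * (LINT y|std_normal_distribution. (a y)\<^sup>2)" (is ?B)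
proof -
  let ?V = "LINT y|std_normal_distribution. (a y)\<^sup>2"
  have fin: "finite J" using K finite_subset by blast
  have [measurable]: "a \<in> borel_measurable borel" using borel_measurable_integrable[OF a(1)] by simp
  have s: "(\<Sum>k\<in>J. c k * a (x k))\<^sup>2 = (\<Sum>k\<in>J. \<Sum>l\<in>J. c k * c l * (a (x k) * a (x l)))" for x
    by (simp add: power2_eq_square sum_product mult_ac)
  have i: "integrable (std_gaussian_on K) (\<lambda>x. a (x k) * a (x l))"
    and e: "(LINT x|std_gaussian_on K. a (x k) * a (x l)) = (if k = l then ?V else 0)"
    if "k \<in> J" "l \<in> J" for k l
    using that K integral_product_two_components[OF K(1) _ _ _ a, of k l]
      integrable_component[of k K "\<lambda>y. (a y)\<^sup>2"] integral_component[of k K "\<lambda>y. (a y)\<^sup>2"] a2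
    by (auto simp: power2_eq_square subset_iff)
  show ?A unfolding s using i by auto
  have "(LINT x|std_gaussian_on K. (\<Sum>k\<in>J. c k * a (x k))\<^sup>2) = (\<Sum>k\<in>J. \<Sum>l\<in>J. c k * c l * (if k = l then ?V else 0))"
    unfolding s using i e by (simp add: Bochner_Integration.integral_sum)
  also have "\<dots> = (\<Sum>k\<in>J. c k * c k * ?V)"
    using fin by (intro sum.cong refl) (simp add: if_distrib[of "\<lambda>z. _ * z"] cong: if_cong)
  finally show ?B by (simp add: power2_eq_square sum_distrib_right)
qed

section \<open>Interpolation between two groups of Gaussian coordinates\<close>

text \<open>
  The mean value theorem bounds the difference quotients by \<open>w\<close>, so dominated convergence applies.
\<close>

lemma has_real_derivative_integral:
  fixes f f' :: "real \<Rightarrow> 'a \<Rightarrow> real"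
  assumes d: "\<And>t x. ((\<lambda>t. f t x) has_real_derivative f' t x) (at t)"
    and w: "\<And>t x. \<bar>f' t x\<bar> \<le> w x" "integrable M w"
    and f: "\<And>t. integrable M (f t)" and f': "\<And>t. f' t \<in> borel_measurable M"
  shows "((\<lambda>t. LINT x|M. f t x) has_real_derivative (LINT x|M. f' t x)) (at t)"
proof -
  have [measurable]: "f t \<in> borel_measurable M" for t using f by auto
  have "(\<lambda>i. ((LINT x|M. f (t + h i) x) - (LINT x|M. f t x)) / h i) \<longlonglongrightarrow> (LINT x|M. f' t x)"
    if h: "\<And>i. h i \<noteq> 0" "h \<longlonglongrightarrow> 0" for h
  proof -
    have "(\<lambda>i. LINT x|M. (f (t + h i) x - f t x) / h i) \<longlonglongrightarrow> (LINT x|M. f' t x)"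
    proof (rule integral_dominated_convergence[where w=w])
      show "AE x in M. (\<lambda>i. (f (t + h i) x - f t x) / h i) \<longlonglongrightarrow> f' t x"
      proof (rule AE_I2)
        fix x
        have "((\<lambda>h. (f (t + h) x - f t x) / h) \<longlongrightarrow> f' t x) (at 0)"
          using d[of x t] by (simp add: DERIV_def)
        then show "(\<lambda>i. (f (t + h i) x - f t x) / h i) \<longlonglongrightarrow> f' t x"
          using h by (auto simp: tendsto_at_iff_sequentially comp_def)
      qed
      show "AE x in M. norm ((f (t + h i) x - f t x) / h i) \<le> w x" for i
      proof (rule AE_I2)
        fix x
        have "norm (f (t + h i) x - f t x) \<le> w x * norm (t + h i - t)"
          by (rule field_differentiable_bound[where S=UNIV and f'="\<lambda>t. f' t x"])
             (use d w(1) in auto)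
        then show "norm ((f (t + h i) x - f t x) / h i) \<le> w x"
          using h(1)[of i] by (simp add: field_simps)
      qed
    qed (use w f' in auto)
    moreover have "(LINT x|M. (f (t + h i) x - f t x) / h i)
        = ((LINT x|M. f (t + h i) x) - (LINT x|M. f t x)) / h i" for i
      using Bochner_Integration.integral_diff[OF f f, of "t + h i" t] by simp
    ultimately show ?thesis by (simp only:)
  qed
  then show ?thesis
    unfolding DERIV_def by (auto simp: tendsto_at_iff_sequentially comp_def)
qed

text \<open>
  Outside \<open>K\<close> the points of the product space are undefined. The factor \<open>1\<close> there keeps the scaled
  point in the space.
\<close>

lemma measurable_scale_std_gaussian_on:
  assumes "\<And>k. k \<notin> K \<Longrightarrow> s k = (1::real)"
  shows "(\<lambda>x k. s k * x k) \<in> measurable (std_gaussian_on K) (std_gaussian_on K)"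
  unfolding std_gaussian_on_def
proof (rule measurable_PiM_single')
  fix k assume k: "k \<in> K"
  have "(\<lambda>x. s k * x k) \<in> borel_measurable (std_gaussian_on K)"
    by (rule borel_measurable_times[OF borel_measurable_const std_gaussian_on_component[OF k]])
  then show "(\<lambda>x. s k * x k) \<in> measurable (Pi\<^sub>M K (\<lambda>_. std_normal_distribution)) std_normal_distribution"
    by (simp add: std_gaussian_on_def cong: measurable_cong_sets)
next
  show "(\<lambda>x k. s k * x k) \<in> space (Pi\<^sub>M K (\<lambda>_. std_normal_distribution)) \<rightarrow> (\<Pi>\<^sub>E i\<in>K. space std_normal_distribution)"
    using assms by (auto simp: space_PiM PiE_def extensional_def)
qed

text \<open>
  Multiply the coordinates in \<open>A\<close> by \<open>sin t\<close> and those in \<open>A'\<close> by \<open>cos t\<close>, and let \<open>t\<close> run from \<open>0\<close> to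
  \<open>pi / 2\<close>. Stein's identity turns the derivative of the mean of \<open>F\<close> into \<open>sin t cos t\<close> times the mean of
  the Laplacian of \<open>F\<close> in the variables \<open>A\<close> minus the Laplacian in the variables \<open>A'\<close>. The hypothesis
  \<open>sign\<close> says that this difference is nonnegative.

  The first derivatives are described by the chain rule along arbitrary paths, which replaces a
  total derivative on a space of functions.
\<close>

theorem gaussian_interpolation:
  fixes F :: "('k \<Rightarrow> real) \<Rightarrow> real" and D1 D2 :: "'k \<Rightarrow> ('k \<Rightarrow> real) \<Rightarrow> real"
  assumes fin: "finite A" "finite A'" "A \<inter> A' = {}" and K: "K = A \<union> A'"
    and F: "\<And>x x' t. (\<And>k. k \<in> K \<Longrightarrow> ((\<lambda>t. x t k) has_real_derivative x' k) (at t)) \<Longrightarrow>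
      ((\<lambda>t. F (x t)) has_real_derivative (\<Sum>k\<in>K. D1 k (x t) * x' k)) (at t)"
    and D1: "\<And>k x y. k \<in> K \<Longrightarrow> ((\<lambda>t. D1 k (x(k := t))) has_real_derivative D2 k (x(k := y))) (at y)"
    and D2: "\<And>k x y. k \<in> K \<Longrightarrow> isCont (\<lambda>t. D2 k (x(k := t))) y"
    and mF: "F \<in> borel_measurable (std_gaussian_on K)"
    and mD: "\<And>k. k \<in> K \<Longrightarrow> D1 k \<in> borel_measurable (std_gaussian_on K)"
      "\<And>k. k \<in> K \<Longrightarrow> D2 k \<in> borel_measurable (std_gaussian_on K)"
    and B: "\<And>x. \<bar>F x\<bar> \<le> B" "\<And>k x. k \<in> K \<Longrightarrow> \<bar>D1 k x\<bar> \<le> B" "\<And>k x. k \<in> K \<Longrightarrow> \<bar>D2 k x\<bar> \<le> B"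
    and sign: "\<And>x. (\<Sum>k\<in>A'. D2 k x) \<le> (\<Sum>k\<in>A. D2 k x)"
  shows "(LINT x|std_gaussian_on K. F (\<lambda>k. if k \<in> A then 0 else x k))
       \<le> (LINT x|std_gaussian_on K. F (\<lambda>k. if k \<in> A' then 0 else x k))"
proof -
  let ?G = "std_gaussian_on K"
  define s where "s t k = (if k \<in> A then sin t else if k \<in> A' then cos t else 1)" for t :: real and k
  define s' where "s' t k = (if k \<in> A then cos t else if k \<in> A' then - sin t else 0)" for t :: real and k
  define z where "z t x = (\<lambda>k. s t k * x k)" for t and x :: "'k \<Rightarrow> real"
  define f' where "f' t x = (\<Sum>k\<in>K. D1 k (z t x) * (s' t k * x k))" for t x
  have finK: "finite K" using fin K by simp
  have B0: "0 \<le> B" using B(1)[of undefined] by linarith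
  have s1: "\<bar>s t k\<bar> \<le> 1" "\<bar>s' t k\<bar> \<le> 1" for t k by (auto simp: s_def s'_def)
  have mz: "(\<lambda>x. z t x) \<in> measurable ?G ?G" for t
    unfolding z_def by (rule measurable_scale_std_gaussian_on) (auto simp: s_def K)
  have mFz: "(\<lambda>x. F (z t x)) \<in> borel_measurable ?G" for t
    by (rule measurable_compose[OF mz mF])
  have mD1z: "(\<lambda>x. D1 k (z t x)) \<in> borel_measurable ?G" if "k \<in> K" for t k
    by (rule measurable_compose[OF mz mD(1)[OF that]])
  have mD2z: "(\<lambda>x. D2 k (z t x)) \<in> borel_measurable ?G" if "k \<in> K" for t k
    by (rule measurable_compose[OF mz mD(2)[OF that]])
  have id1: "integrable ?G (\<lambda>x. x k * D1 k (z t x))" if "k \<in> K" for k t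
    by (rule integrable_component_mult[OF that mD1z[OF that] B(2)[OF that]])
  have f'_alt: "f' t = (\<lambda>x. \<Sum>k\<in>K. s' t k * (x k * D1 k (z t x)))" for t
    unfolding f'_def by (intro ext sum.cong) (auto simp: mult_ac)
  have if': "integrable ?G (f' t)" for t
    unfolding f'_alt by (intro Bochner_Integration.integrable_sum integrable_mult_right id1)
  have ds: "((\<lambda>t. s t k) has_real_derivative s' t k) (at t)" for t k
    unfolding s_def s'_def by (cases "k \<in> A"; cases "k \<in> A'") (auto intro!: derivative_eq_intros)
  have deriv: "((\<lambda>t. LINT x|?G. F (z t x)) has_real_derivative (LINT x|?G. f' t x)) (at t)" for t
  proof (rule has_real_derivative_integral[where w="\<lambda>x. \<Sum>k\<in>K. B * \<bar>x k\<bar>"])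
    show "((\<lambda>t. F (z t x)) has_real_derivative f' t x) (at t)" for t x
      unfolding f'_def
    proof (rule F)
      show "((\<lambda>t. z t x k) has_real_derivative s' t k * x k) (at t)" for k
        unfolding z_def by (rule DERIV_cmult_right[OF ds])
    qed
    show "\<bar>f' t x\<bar> \<le> (\<Sum>k\<in>K. B * \<bar>x k\<bar>)" for t x
      unfolding f'_def
    proof (rule order_trans[OF sum_abs sum_mono])
      fix k assume k: "k \<in> K"
      have "\<bar>s' t k * x k\<bar> \<le> 1 * \<bar>x k\<bar>" unfolding abs_mult by (intro mult_right_mono s1) simp
      then have "\<bar>D1 k (z t x)\<bar> * \<bar>s' t k * x k\<bar> \<le> B * \<bar>x k\<bar>"
        using B0 B(2)[OF k] by (intro mult_mono) auto
      then show "\<bar>D1 k (z t x) * (s' t k * x k)\<bar> \<le> B * \<bar>x k\<bar>" by (simp only: abs_mult)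
    qed
    show "integrable ?G (\<lambda>x. \<Sum>k\<in>K. B * \<bar>x k\<bar>)"
    proof (intro Bochner_Integration.integrable_sum integrable_mult_right integrable_abs)
      fix k assume k: "k \<in> K"
      show "integrable ?G (\<lambda>x. x k)"
        by (rule integrable_component[OF k, of "\<lambda>y. y"], rule measurable_ident_sets[OF refl],
            rule integrable_std_normal_pow[of 1, unfolded power_one_right])
    qed
    show "integrable ?G (\<lambda>x. F (z t x))" for t by (rule integrable_bounded[OF mFz B(1)])
    show "f' t \<in> borel_measurable ?G" for t using if' by (rule borel_measurable_integrable)
  qed
  \<comment> \<open>Stein's identity for the scaled point produces another factor \<open>s t k\<close>\<close>
  have ibp: "(LINT x|?G. x k * D1 k (z t x)) = s t k * (LINT x|?G. D2 k (z t x))" if k: "k \<in> K" for k t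
  proof -
    have zu: "z t (x(k := y)) = (z t x)(k := s t k * y)" for x y by (auto simp: z_def)
    have "(LINT x|?G. x k * D1 k (z t x)) = (LINT x|?G. s t k * D2 k (z t x))"
    proof (rule stein_std_gaussian_on[OF finK k mD1z[OF k] _ _ _ B(2)[OF k]])
      show "(\<lambda>x. s t k * D2 k (z t x)) \<in> borel_measurable ?G"
        by (rule borel_measurable_times[OF borel_measurable_const mD2z[OF k]])
      show "((\<lambda>u. D1 k (z t (x(k := u)))) has_real_derivative s t k * D2 k (z t (x(k := y)))) (at y)" for x y
        unfolding zu using DERIV_chain2[OF D1[OF k, of "z t x" "s t k * y"] DERIV_cmult_Id[of "s t k"]]
        by (simp add: mult.commute)
      show "isCont (\<lambda>u. s t k * D2 k (z t (x(k := u)))) y" for x y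
        unfolding zu
        by (intro isCont_mult continuous_const isCont_o2[OF _ D2[OF k], of y "\<lambda>u. s t k * u"] continuous_ident)
      show "\<bar>s t k * D2 k (z t x)\<bar> \<le> B" for x
        using mult_mono[OF s1(1)[of t k] B(3)[OF k, of "z t x"]] by (simp add: abs_mult)
    qed
    then show ?thesis by simp
  qed
  have pos: "0 \<le> (LINT x|?G. f' t x)" if t: "0 \<le> t" "t \<le> pi / 2" for t
  proof -
    have iD2: "integrable ?G (\<lambda>x. D2 k (z t x))" if "k \<in> K" for k
      by (rule integrable_bounded[OF mD2z[OF that] B(3)[OF that]])
    let ?I = "\<lambda>k. LINT x|?G. D2 k (z t x)"
    have "(LINT x|?G. f' t x) = (\<Sum>k\<in>K. s' t k * (s t k * ?I k))"
      unfolding f'_alt using id1 ibp by (simp add: Bochner_Integration.integral_sum)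
    also have "\<dots> = (\<Sum>k\<in>A. s' t k * (s t k * ?I k)) + (\<Sum>k\<in>A'. s' t k * (s t k * ?I k))"
      unfolding K using fin by (simp add: sum.union_disjoint)
    also have "(\<Sum>k\<in>A. s' t k * (s t k * ?I k)) = sin t * cos t * (\<Sum>k\<in>A. ?I k)"
      unfolding sum_distrib_left by (intro sum.cong) (auto simp: s_def s'_def)
    also have "(\<Sum>k\<in>A'. s' t k * (s t k * ?I k)) = - (sin t * cos t * (\<Sum>k\<in>A'. ?I k))"
      unfolding sum_distrib_left sum_negf[symmetric]
      using fin(3) by (intro sum.cong) (auto simp: s_def s'_def)
    finally have "(LINT x|?G. f' t x) = sin t * cos t * ((\<Sum>k\<in>A. ?I k) - (\<Sum>k\<in>A'. ?I k))"
      by (simp add: algebra_simps)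
    moreover have "(\<Sum>k\<in>A'. ?I k) \<le> (\<Sum>k\<in>A. ?I k)"
    proof -
      have "(\<Sum>k\<in>A'. ?I k) = (LINT x|?G. (\<Sum>k\<in>A'. D2 k (z t x)))"
        using iD2 K by (subst Bochner_Integration.integral_sum) auto
      also have "\<dots> \<le> (LINT x|?G. (\<Sum>k\<in>A. D2 k (z t x)))"
        using iD2 K by (intro integral_mono Bochner_Integration.integrable_sum sign) auto
      also have "\<dots> = (\<Sum>k\<in>A. ?I k)"
        using iD2 K by (subst Bochner_Integration.integral_sum) auto
      finally show ?thesis .
    qed
    moreover have "0 \<le> sin t" "0 \<le> cos t" using t by (auto intro: sin_ge_zero cos_ge_zero)
    ultimately show ?thesis by simp
  qed
  have "(LINT x|?G. F (z 0 x)) \<le> (LINT x|?G. F (z (pi / 2) x))"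
    by (rule DERIV_nonneg_imp_nondecreasing[where f="\<lambda>t. LINT x|?G. F (z t x)"]) (use deriv pos in auto)
  moreover have "z 0 x = (\<lambda>k. if k \<in> A then 0 else x k)" for x
    by (rule ext) (auto simp: z_def s_def)
  moreover have "z (pi / 2) x = (\<lambda>k. if k \<in> A' then 0 else x k)" for x
    using fin(3) by (intro ext) (auto simp: z_def s_def)
  ultimately show ?thesis by simp
qed

section \<open>Gordon's comparison\<close>

text \<open>
  One Gaussian vector \<open>\<xi>\<close> indexed by \<open>{..m} \<times> {..N}\<close> carries all the randomness: the matrix \<open>G\<close> sits at
  \<open>i < m\<close>, \<open>j < N\<close>, the vector \<open>g\<close> in the last column, the vector \<open>h\<close> in the last row, and the scalar \<open>\<gamma>\<close>
  in the corner.

  The family interpolating between the two sides of Gordon's comparison is \<open>level\<close>. The functional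
  \<open>F\<close> is close to \<open>1\<close> if all levels are well above \<open>0\<close> and close to \<open>0\<close> if one of them is well below \<open>0\<close>;
  a large \<open>\<beta>\<close> makes the transition sharp.
\<close>

locale gordon_functional =
  fixes N m :: nat and V :: "(nat \<Rightarrow> real) set" and \<sigma> \<beta> :: real and c :: "(nat \<Rightarrow> real) \<Rightarrow> real"
  assumes finV: "finite V" and V1: "\<And>v. v \<in> V \<Longrightarrow> norm2 N v \<le> 1"
    and \<sigma>: "\<bar>\<sigma>\<bar> = 1" and \<beta>: "0 < \<beta>"
begin

text \<open>
  The vector \<open>(v, \<parallel>v\<parallel>)\<close>, which lies on the light cone of the Lorentz form below.
\<close>

definition light_lift :: "(nat \<Rightarrow> real) \<Rightarrow> nat \<Rightarrow> real" where
  "light_lift v j = (if j < N then v j else norm2 N v)"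

definition row :: "nat \<Rightarrow> (nat \<Rightarrow> real) \<Rightarrow> (nat \<times> nat \<Rightarrow> real) \<Rightarrow> real" where
  "row i v \<xi> = (\<Sum>j\<le>N. \<xi> (i, j) * light_lift v j)"

text \<open>
  A smooth substitute for the norm of the first \<open>m\<close> rows: it exceeds that norm by at most \<open>1\<close> and its
  gradient has length below \<open>1\<close>.
\<close>

definition len :: "(nat \<Rightarrow> real) \<Rightarrow> (nat \<times> nat \<Rightarrow> real) \<Rightarrow> real" where
  "len v \<xi> = sqrt (1 + (\<Sum>i<m. (row i v \<xi>)\<^sup>2))"

definition level :: "(nat \<Rightarrow> real) \<Rightarrow> (nat \<times> nat \<Rightarrow> real) \<Rightarrow> real" where
  "level v \<xi> = \<sigma> * len v \<xi> + row m v \<xi> + c v"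

text \<open>
  First and second partial derivatives of \<open>level v\<close> in the coordinate \<open>k\<close>. Below, \<open>D1\<close> and \<open>D2\<close> are those
  of \<open>F\<close>.
\<close>

definition level_d1 :: "nat \<times> nat \<Rightarrow> (nat \<Rightarrow> real) \<Rightarrow> (nat \<times> nat \<Rightarrow> real) \<Rightarrow> real" where
  "level_d1 k v \<xi> = (if fst k < m then \<sigma> * (row (fst k) v \<xi> / len v \<xi>) else 1) * light_lift v (snd k)"

definition level_d2 :: "nat \<times> nat \<Rightarrow> (nat \<Rightarrow> real) \<Rightarrow> (nat \<times> nat \<Rightarrow> real) \<Rightarrow> real" where
  "level_d2 k v \<xi> = (if fst k < m then \<sigma> * (1 / len v \<xi> - (row (fst k) v \<xi>)\<^sup>2 / len v \<xi> ^ 3) else 0)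
     * (light_lift v (snd k))\<^sup>2"

definition weight :: "(nat \<Rightarrow> real) \<Rightarrow> (nat \<times> nat \<Rightarrow> real) \<Rightarrow> real" where
  "weight v \<xi> = exp (- \<beta> * level v \<xi>)"

definition F :: "(nat \<times> nat \<Rightarrow> real) \<Rightarrow> real" where
  "F \<xi> = exp (- (\<Sum>v\<in>V. weight v \<xi>))"

definition D1 :: "nat \<times> nat \<Rightarrow> (nat \<times> nat \<Rightarrow> real) \<Rightarrow> real" where
  "D1 k \<xi> = F \<xi> * (\<beta> * (\<Sum>v\<in>V. weight v \<xi> * level_d1 k v \<xi>))"

definition D2 :: "nat \<times> nat \<Rightarrow> (nat \<times> nat \<Rightarrow> real) \<Rightarrow> real" where
  "D2 k \<xi> = F \<xi> * ((\<beta> * (\<Sum>v\<in>V. weight v \<xi> * level_d1 k v \<xi>))\<^sup>2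
     + \<beta> * (\<Sum>v\<in>V. weight v \<xi> * (level_d2 k v \<xi> - \<beta> * (level_d1 k v \<xi>)\<^sup>2)))"

abbreviation "K \<equiv> {..m} \<times> {..N}"

lemma len_ge_1: "1 \<le> len v \<xi>"
  unfolding len_def by (simp add: sum_nonneg)

lemma len_pos [simp]: "0 < len v \<xi>" "len v \<xi> \<noteq> 0"
  using len_ge_1[of v \<xi>] by auto

lemma len_sq: "(len v \<xi>)\<^sup>2 = 1 + (\<Sum>i<m. (row i v \<xi>)\<^sup>2)"
  unfolding len_def by (simp add: sum_nonneg add_nonneg_nonneg)

lemma row_deriv:
  assumes "\<And>k. k \<in> K \<Longrightarrow> ((\<lambda>t. x t k) has_real_derivative x' k) (at t)" "i \<le> m"
  shows "((\<lambda>t. row i v (x t)) has_real_derivative (\<Sum>j\<le>N. x' (i, j) * light_lift v j)) (at t)"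
  unfolding row_def using assms by (intro DERIV_sum DERIV_cmult_right) auto

lemma len_deriv:
  assumes "\<And>i. i < m \<Longrightarrow> ((\<lambda>t. row i v (x t)) has_real_derivative r' i) (at t)"
  shows "((\<lambda>t. len v (x t)) has_real_derivative (\<Sum>i<m. row i v (x t) / len v (x t) * r' i)) (at t)"
proof -
  have "((\<lambda>t. 1 + (\<Sum>i<m. (row i v (x t))\<^sup>2)) has_real_derivative (\<Sum>i<m. 2 * (row i v (x t) * r' i))) (at t)"
    using assms by (auto intro!: derivative_eq_intros sum.cong simp: mult_ac)
  moreover have "0 < 1 + (\<Sum>i<m. (row i v (x t))\<^sup>2)"
    by (simp add: sum_nonneg add_pos_nonneg)
  ultimately have "((\<lambda>t. len v (x t)) has_real_derivative
      (\<Sum>i<m. 2 * (row i v (x t) * r' i)) * (inverse (len v (x t)) / 2)) (at t)"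
    unfolding len_def by (intro DERIV_chain2[OF DERIV_real_sqrt, THEN DERIV_cong]) auto
  then show ?thesis
    by (rule DERIV_cong) (simp add: sum_distrib_left sum_distrib_right field_simps)
qed

lemma sum_K: "(\<Sum>k\<in>K. f k) = (\<Sum>i<m. \<Sum>j\<le>N. f (i, j)) + (\<Sum>j\<le>N. f (m, j))"
proof -
  have "(\<Sum>k\<in>K. f k) = (\<Sum>i\<le>m. \<Sum>j\<le>N. f (i, j))"
    by (simp add: sum.cartesian_product)
  then show ?thesis by (simp add: lessThan_Suc_atMost[symmetric])
qed

lemma level_deriv:
  assumes "\<And>k. k \<in> K \<Longrightarrow> ((\<lambda>t. x t k) has_real_derivative x' k) (at t)"
  shows "((\<lambda>t. level v (x t)) has_real_derivative (\<Sum>k\<in>K. level_d1 k v (x t) * x' k)) (at t)"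
proof -
  have "((\<lambda>t. level v (x t)) has_real_derivative
      \<sigma> * (\<Sum>i<m. row i v (x t) / len v (x t) * (\<Sum>j\<le>N. x' (i, j) * light_lift v j)) + (\<Sum>j\<le>N. x' (m, j) * light_lift v j) + 0) (at t)"
    unfolding level_def
    by (intro DERIV_add DERIV_cmult DERIV_const len_deriv row_deriv assms) auto
  moreover have "\<sigma> * (\<Sum>i<m. row i v (x t) / len v (x t) * (\<Sum>j\<le>N. x' (i, j) * light_lift v j)) + (\<Sum>j\<le>N. x' (m, j) * light_lift v j) + 0
    = (\<Sum>k\<in>K. level_d1 k v (x t) * x' k)"
    unfolding sum_K level_d1_def by (simp add: sum_distrib_left sum_distrib_right sum_divide_distrib mult_ac)
  ultimately show ?thesis by simp
qed

lemma weight_deriv: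
  assumes "((\<lambda>t. level v (x t)) has_real_derivative l') (at t)"
  shows "((\<lambda>t. weight v (x t)) has_real_derivative - \<beta> * (weight v (x t) * l')) (at t)"
  unfolding weight_def by (rule derivative_eq_intros assms refl)+ simp

lemma F_deriv:
  assumes "\<And>v. ((\<lambda>t. level v (x t)) has_real_derivative l' v) (at t)"
  shows "((\<lambda>t. F (x t)) has_real_derivative F (x t) * (\<beta> * (\<Sum>v\<in>V. weight v (x t) * l' v))) (at t)"
proof -
  have "((\<lambda>t. F (x t)) has_real_derivative F (x t) * (- (\<Sum>v\<in>V. - \<beta> * (weight v (x t) * l' v)))) (at t)"
    unfolding F_def
    by (rule DERIV_chain2[OF DERIV_exp]) (intro DERIV_minus DERIV_sum weight_deriv assms)
  then show ?thesis by (simp add: sum_negf sum_distrib_left)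
qed

lemma F_path:
  assumes "\<And>k. k \<in> K \<Longrightarrow> ((\<lambda>t. x t k) has_real_derivative x' k) (at t)"
  shows "((\<lambda>t. F (x t)) has_real_derivative (\<Sum>k\<in>K. D1 k (x t) * x' k)) (at t)"
proof -
  have "(\<Sum>k\<in>K. D1 k (x t) * x' k) = F (x t) * (\<beta> * (\<Sum>v\<in>V. weight v (x t) * (\<Sum>k\<in>K. level_d1 k v (x t) * x' k)))"
    unfolding D1_def sum_distrib_left sum_distrib_right
    by (subst sum.swap) (simp add: mult_ac)
  then show ?thesis using F_deriv[OF level_deriv[OF assms]] by simp
qed

context
  fixes k :: "nat \<times> nat" and x :: "nat \<times> nat \<Rightarrow> real"
  assumes k: "k \<in> K"
begin

lemma coordinate_path: "((\<lambda>t. (x(k := t)) l) has_real_derivative (if l = k then 1 else 0)) (at y)"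
  by (auto intro!: derivative_eq_intros)

lemma row_coordinate:
  "i \<le> m \<Longrightarrow> ((\<lambda>t. row i v (x(k := t))) has_real_derivative (if i = fst k then light_lift v (snd k) else 0)) (at y)"
proof (rule DERIV_cong[OF row_deriv[OF coordinate_path]])
  show "(\<Sum>j\<le>N. (if (i, j) = k then 1 else 0) * light_lift v j) = (if i = fst k then light_lift v (snd k) else 0)"
    using k by (cases k) (auto simp: if_distrib[of "\<lambda>z. z * _"] cong: if_cong)
qed

lemma len_coordinate:
  "((\<lambda>t. len v (x(k := t))) has_real_derivative
     (if fst k < m then row (fst k) v (x(k := y)) / len v (x(k := y)) * light_lift v (snd k) else 0)) (at y)"
proof (rule DERIV_cong[OF len_deriv[OF row_coordinate]])
  show "(\<Sum>i<m. row i v (x(k := y)) / len v (x(k := y)) * (if i = fst k then light_lift v (snd k) else 0))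
     = (if fst k < m then row (fst k) v (x(k := y)) / len v (x(k := y)) * light_lift v (snd k) else 0)"
    by (simp add: if_distrib[of "\<lambda>z. _ * z"] sum.delta cong: if_cong)
qed simp

lemma level_coordinate: "((\<lambda>t. level v (x(k := t))) has_real_derivative level_d1 k v (x(k := y))) (at y)"
proof (rule DERIV_cong[OF level_deriv[OF coordinate_path]])
  show "(\<Sum>l\<in>K. level_d1 l v (x(k := y)) * (if l = k then 1 else 0)) = level_d1 k v (x(k := y))"
    using k by (simp add: if_distrib[of "\<lambda>z. _ * z"] sum.delta cong: if_cong)
qed

lemma level_d1_coordinate: "((\<lambda>t. level_d1 k v (x(k := t))) has_real_derivative level_d2 k v (x(k := y))) (at y)"
proof (cases "fst k < m")
  case True
  let ?r = "row (fst k) v (x(k := y))" and ?l = "len v (x(k := y))" and ?e = "light_lift v (snd k)"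
  have "((\<lambda>t. \<sigma> * (row (fst k) v (x(k := t)) / len v (x(k := t))) * ?e) has_real_derivative
     \<sigma> * ((?e * ?l - ?r * (?r / ?l * ?e)) / (?l * ?l)) * ?e) (at y)"
    using row_coordinate[of "fst k" v y] len_coordinate[of v y] True
    by (intro DERIV_cmult_right DERIV_cmult DERIV_divide) auto
  moreover have "\<sigma> * ((?e * ?l - ?r * (?r / ?l * ?e)) / (?l * ?l)) * ?e = level_d2 k v (x(k := y))"
    using True by (simp add: level_d2_def field_simps power2_eq_square power3_eq_cube)
  ultimately show ?thesis using True by (simp add: level_d1_def)
qed (simp add: level_d1_def level_d2_def)

lemma D1_coordinate: "((\<lambda>t. D1 k (x(k := t))) has_real_derivative D2 k (x(k := y))) (at y)"
proof -
  let ?x = "x(k := y)"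
  have "((\<lambda>t. D1 k (x(k := t))) has_real_derivative
      F ?x * (\<beta> * (\<Sum>v\<in>V. weight v ?x * level_d1 k v ?x)) * (\<beta> * (\<Sum>v\<in>V. weight v ?x * level_d1 k v ?x))
    + \<beta> * (\<Sum>v\<in>V. - \<beta> * (weight v ?x * level_d1 k v ?x) * level_d1 k v ?x + level_d2 k v ?x * weight v ?x) * F ?x) (at y)"
    unfolding D1_def
    by (intro DERIV_mult DERIV_cmult DERIV_sum F_deriv weight_deriv level_coordinate level_d1_coordinate)
  moreover have "(\<Sum>v\<in>V. - \<beta> * (weight v ?x * level_d1 k v ?x) * level_d1 k v ?x + level_d2 k v ?x * weight v ?x)
    = (\<Sum>v\<in>V. weight v ?x * (level_d2 k v ?x - \<beta> * (level_d1 k v ?x)\<^sup>2))"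
    by (intro sum.cong) (auto simp: algebra_simps power2_eq_square)
  ultimately show ?thesis
    by (elim DERIV_cong) (simp add: D2_def algebra_simps power2_eq_square)
qed

lemma D2_continuous: "isCont (\<lambda>t. D2 k (x(k := t))) y"
proof -
  have l: "isCont (\<lambda>t. len v (x(k := t))) y" "isCont (\<lambda>t. level v (x(k := t))) y"
    "isCont (\<lambda>t. row (fst k) v (x(k := t))) y" "isCont (\<lambda>t. level_d1 k v (x(k := t))) y" for v
    using k len_coordinate[THEN DERIV_isCont] level_coordinate[THEN DERIV_isCont]
      row_coordinate[THEN DERIV_isCont] level_d1_coordinate[THEN DERIV_isCont] by auto
  have w: "isCont (\<lambda>t. weight v (x(k := t))) y" for v
    using weight_deriv[OF level_coordinate] by (rule DERIV_isCont)
  have f: "isCont (\<lambda>t. F (x(k := t))) y"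
    using F_deriv[OF level_coordinate] by (rule DERIV_isCont)
  have l2: "isCont (\<lambda>t. level_d2 k v (x(k := t))) y" for v
    unfolding level_d2_def by (cases "fst k < m") (auto intro!: continuous_intros l)
  show ?thesis unfolding D2_def by (intro continuous_intros f w l l2)
qed

end

lemma light_lift_le_1: "v \<in> V \<Longrightarrow> \<bar>light_lift v j\<bar> \<le> 1"
proof -
  assume v: "v \<in> V"
  have "\<bar>v j\<bar> \<le> norm2 N v" if "j < N"
    using member_le_L2_set[of "{..<N}" j "\<lambda>i. \<bar>v i\<bar>"] that by (simp add: L2_set_def)
  then show ?thesis using V1[OF v] by (auto simp: light_lift_def)
qed

lemma row_le_len: "i < m \<Longrightarrow> \<bar>row i v \<xi>\<bar> \<le> len v \<xi>"
proof -
  assume i: "i < m"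
  have "(row i v \<xi>)\<^sup>2 \<le> (\<Sum>i<m. (row i v \<xi>)\<^sup>2)" using i by (intro member_le_sum) auto
  then have "\<bar>row i v \<xi>\<bar>\<^sup>2 \<le> (len v \<xi>)\<^sup>2" unfolding len_sq by simp
  then show ?thesis by (rule power2_le_imp_le) (simp add: less_imp_le)
qed

lemma level_d1_le_1: "v \<in> V \<Longrightarrow> \<bar>level_d1 k v \<xi>\<bar> \<le> 1"
proof -
  assume v: "v \<in> V"
  have "\<bar>if fst k < m then \<sigma> * (row (fst k) v \<xi> / len v \<xi>) else 1\<bar> \<le> 1"
    using \<sigma> row_le_len[of "fst k" v \<xi>] by (auto simp: abs_mult abs_divide)
  then show ?thesis unfolding level_d1_def abs_mult using light_lift_le_1[OF v] by (intro mult_le_one) auto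
qed

lemma level_d2_le_1: "v \<in> V \<Longrightarrow> \<bar>level_d2 k v \<xi>\<bar> \<le> 1"
proof -
  assume v: "v \<in> V"
  let ?l = "len v \<xi>" and ?r = "row (fst k) v \<xi>"
  have "\<bar>1 / ?l - ?r\<^sup>2 / ?l ^ 3\<bar> \<le> 1" if "fst k < m"
  proof -
    have "?r\<^sup>2 \<le> ?l\<^sup>2" using row_le_len[OF that, of v \<xi>] by (metis abs_ge_zero power2_abs power_mono)
    then have "0 \<le> 1 - ?r\<^sup>2 / ?l\<^sup>2" "1 - ?r\<^sup>2 / ?l\<^sup>2 \<le> 1" by auto
    moreover have "0 \<le> 1 / ?l" "1 / ?l \<le> 1" using len_ge_1[of v \<xi>] by auto
    moreover have "1 / ?l - ?r\<^sup>2 / ?l ^ 3 = 1 / ?l * (1 - ?r\<^sup>2 / ?l\<^sup>2)"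
      by (simp add: field_simps power2_eq_square power3_eq_cube)
    ultimately show ?thesis by (simp only: abs_of_nonneg mult_nonneg_nonneg mult_le_one)
  qed
  then have "\<bar>if fst k < m then \<sigma> * (1 / ?l - ?r\<^sup>2 / ?l ^ 3) else 0\<bar> \<le> 1"
    using \<sigma> by (auto simp: abs_mult)
  moreover have "\<bar>(light_lift v (snd k))\<^sup>2\<bar> \<le> 1" using light_lift_le_1[OF v, of "snd k"] by (simp add: abs_square_le_1)
  ultimately show ?thesis unfolding level_d2_def abs_mult by (intro mult_le_one) auto
qed

lemma F_bounds: "0 < F \<xi>" "F \<xi> \<le> 1"
  by (auto simp: F_def weight_def sum_nonneg)

lemma weighted_sum_bound:
  assumes "\<And>v. v \<in> V \<Longrightarrow> \<bar>a v\<bar> \<le> L"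
  shows "\<bar>\<Sum>v\<in>V. weight v \<xi> * a v\<bar> \<le> (\<Sum>v\<in>V. weight v \<xi>) * L"
  unfolding sum_distrib_right
  by (rule order_trans[OF sum_abs sum_mono]) (auto simp: abs_mult weight_def intro!: mult_left_mono assms)

text \<open>
  The weights are unbounded, but \<open>F\<close> is \<open>exp (- R)\<close> for their sum \<open>R\<close> and so absorbs any power of \<open>R\<close>.
  This is why all derivatives of \<open>F\<close> are bounded.
\<close>

lemma F_times_weight:
  defines "R \<equiv> \<lambda>\<xi>. (\<Sum>v\<in>V. weight v \<xi>)"
  shows "F \<xi> * R \<xi> \<le> 1" "F \<xi> * (R \<xi>)\<^sup>2 \<le> 2" "0 \<le> R \<xi>"
proof -
  have F_eq: "F \<xi> = exp (- R \<xi>)" by (simp add: F_def R_def)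
  show R0: "0 \<le> R \<xi>" by (auto simp: R_def weight_def sum_nonneg)
  have "1 + R \<xi> + (R \<xi>)\<^sup>2 / 2 \<le> exp (R \<xi>)" by (rule exp_lower_Taylor_quadratic[OF R0])
  moreover have "0 \<le> (R \<xi>)\<^sup>2" by simp
  ultimately have "R \<xi> \<le> exp (R \<xi>)" "(R \<xi>)\<^sup>2 \<le> 2 * exp (R \<xi>)" using R0 by linarith+
  then show "F \<xi> * R \<xi> \<le> 1" "F \<xi> * (R \<xi>)\<^sup>2 \<le> 2"
    unfolding F_eq exp_minus by (auto simp: field_simps)
qed

lemma D1_bound: "\<bar>D1 k \<xi>\<bar> \<le> \<beta>"
proof -
  let ?R = "\<Sum>v\<in>V. weight v \<xi>"
  have "\<bar>D1 k \<xi>\<bar> = \<beta> * (F \<xi> * \<bar>\<Sum>v\<in>V. weight v \<xi> * level_d1 k v \<xi>\<bar>)"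
    using \<beta> F_bounds[of \<xi>] by (simp add: D1_def abs_mult)
  also have "\<dots> \<le> \<beta> * (F \<xi> * (?R * 1))"
    using \<beta> F_bounds[of \<xi>] by (intro mult_left_mono weighted_sum_bound level_d1_le_1) auto
  also have "\<dots> \<le> \<beta> * 1" using \<beta> F_times_weight(1)[of \<xi>] by (intro mult_left_mono) auto
  finally show ?thesis by simp
qed

lemma D2_bound: "\<bar>D2 k \<xi>\<bar> \<le> 3 * \<beta>\<^sup>2 + \<beta>"
proof -
  let ?R = "\<Sum>v\<in>V. weight v \<xi>"
  let ?S = "\<Sum>v\<in>V. weight v \<xi> * level_d1 k v \<xi>" and ?T = "\<Sum>v\<in>V. weight v \<xi> * (level_d2 k v \<xi> - \<beta> * (level_d1 k v \<xi>)\<^sup>2)"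
  have S: "?S\<^sup>2 \<le> ?R\<^sup>2"
    using weighted_sum_bound[of "\<lambda>v. level_d1 k v \<xi>" 1 \<xi>] level_d1_le_1 by (intro abs_le_square_iff[THEN iffD1]) auto
  have T: "\<bar>?T\<bar> \<le> ?R * (1 + \<beta>)"
  proof (rule weighted_sum_bound)
    fix v assume v: "v \<in> V"
    have "(level_d1 k v \<xi>)\<^sup>2 \<le> 1" using level_d1_le_1[OF v, of k \<xi>] by (simp add: abs_square_le_1)
    then have "\<beta> * (level_d1 k v \<xi>)\<^sup>2 \<le> \<beta> * 1" "0 \<le> \<beta> * (level_d1 k v \<xi>)\<^sup>2" using \<beta> by (auto intro!: mult_left_mono)
    then show "\<bar>level_d2 k v \<xi> - \<beta> * (level_d1 k v \<xi>)\<^sup>2\<bar> \<le> 1 + \<beta>" using level_d2_le_1[OF v, of k \<xi>] by linarith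
  qed
  have "\<bar>D2 k \<xi>\<bar> \<le> F \<xi> * (\<beta>\<^sup>2 * ?S\<^sup>2 + \<beta> * \<bar>?T\<bar>)"
    using F_bounds[of \<xi>] \<beta> unfolding D2_def
    by (auto simp: abs_mult power_mult_distrib intro!: mult_left_mono order_trans[OF abs_triangle_ineq])
  also have "\<dots> \<le> F \<xi> * (\<beta>\<^sup>2 * ?R\<^sup>2 + \<beta> * (?R * (1 + \<beta>)))"
    using F_bounds[of \<xi>] \<beta> S T by (intro mult_left_mono add_mono) auto
  also have "\<dots> = \<beta>\<^sup>2 * (F \<xi> * ?R\<^sup>2) + \<beta> * (1 + \<beta>) * (F \<xi> * ?R)"
    by (simp add: algebra_simps)
  also have "\<dots> \<le> \<beta>\<^sup>2 * 2 + \<beta> * (1 + \<beta>) * 1"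
    using \<beta> F_times_weight[of \<xi>] by (intro add_mono mult_left_mono) auto
  finally show ?thesis by (simp add: algebra_simps power2_eq_square)
qed

definition "matrix_part = ({..<m} \<times> {..<N}) \<union> {(m, N)}"
definition "split_part = ({..<m} \<times> {N}) \<union> ({m} \<times> {..<N})"

lemma parts: "finite matrix_part" "finite split_part" "matrix_part \<inter> split_part = {}" "K = matrix_part \<union> split_part"
  by (auto simp: matrix_part_def split_part_def)

text \<open>
  The signed sum over all coordinates is the difference of the two partial Laplacians. The sign is a
  product of a row sign and a column sign, so for products of row and column quantities the signed
  sum factors.
\<close>

definition sgn_part :: "nat \<times> nat \<Rightarrow> real" where
  "sgn_part k = (if fst k < m then 1 else - 1) * (if snd k < N then 1 else - 1)"

lemma sum_parts: "(\<Sum>k\<in>matrix_part. f k) - (\<Sum>k\<in>split_part. f k) = (\<Sum>k\<in>K. sgn_part k * f k)"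
proof -
  have "(\<Sum>k\<in>K. sgn_part k * f k) = (\<Sum>k\<in>matrix_part. sgn_part k * f k) + (\<Sum>k\<in>split_part. sgn_part k * f k)"
    unfolding parts(4) by (rule sum.union_disjoint[OF parts(1-3)])
  moreover have "(\<Sum>k\<in>matrix_part. sgn_part k * f k) = (\<Sum>k\<in>matrix_part. f k)"
    by (intro sum.cong) (auto simp: matrix_part_def sgn_part_def)
  moreover have "(\<Sum>k\<in>split_part. sgn_part k * f k) = (\<Sum>k\<in>split_part. - f k)"
    by (intro sum.cong) (auto simp: split_part_def sgn_part_def)
  ultimately show ?thesis by (simp add: sum_negf)
qed

definition lorentz :: "(nat \<Rightarrow> real) \<Rightarrow> (nat \<Rightarrow> real) \<Rightarrow> real" where
  "lorentz u v = (\<Sum>j\<le>N. (if j < N then 1 else - 1) * (light_lift u j * light_lift v j))"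

lemma lorentz_eq: "lorentz u v = inner_prod N u v - norm2 N u * norm2 N v"
proof -
  have "lorentz u v = (\<Sum>j<N. (if j < N then 1 else - 1) * (light_lift u j * light_lift v j)) - light_lift u N * light_lift v N"
    unfolding lorentz_def by (simp add: lessThan_Suc_atMost[symmetric])
  also have "(\<Sum>j<N. (if j < N then 1 else - 1) * (light_lift u j * light_lift v j)) = inner_prod N u v"
    by (intro sum.cong) (auto simp: light_lift_def)
  finally show ?thesis by (simp add: light_lift_def)
qed

text \<open>
  The Cauchy--Schwarz inequality, with equality for \<open>u = v\<close>.
\<close>

lemma lorentz_le_0: "lorentz u v \<le> 0"
  using norm2_Cauchy_Schwarz[of u v N] by (simp add: lorentz_eq)

lemma lorentz_self: "lorentz v v = 0"
  using norm2_sq[of v N] by (simp add: lorentz_eq power2_eq_square)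

lemma sum_sgn_part:
  "(\<Sum>k\<in>K. sgn_part k * (a (fst k) * (light_lift u (snd k) * light_lift v (snd k)))) = ((\<Sum>i<m. a i) - a m) * lorentz u v"
proof -
  have "(\<Sum>j\<le>N. sgn_part (i, j) * (a i * (light_lift u j * light_lift v j))) = (if i < m then 1 else - 1) * a i * lorentz u v" for i
    unfolding lorentz_def sum_distrib_left by (intro sum.cong) (auto simp: sgn_part_def)
  then show ?thesis
    unfolding sum_K by (simp add: sum_distrib_right[symmetric] left_diff_distrib)
qed

text \<open>
  The inner product of the gradients of the smoothed norms at \<open>u\<close> and \<open>v\<close>.
\<close>

definition corr :: "(nat \<Rightarrow> real) \<Rightarrow> (nat \<Rightarrow> real) \<Rightarrow> (nat \<times> nat \<Rightarrow> real) \<Rightarrow> real" where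
  "corr u v \<xi> = (\<Sum>i<m. row i u \<xi> * row i v \<xi>) / (len u \<xi> * len v \<xi>)"

lemma corr_le_1: "corr u v \<xi> \<le> 1"
proof -
  let ?L = "\<lambda>w. L2_set (\<lambda>i. row i w \<xi>) {..<m}"
  have L: "?L w \<le> len w \<xi>" "0 \<le> ?L w" for w
    by (auto simp: len_def L2_set_def sum_nonneg)
  have "(\<Sum>i<m. row i u \<xi> * row i v \<xi>) \<le> ?L u * ?L v"
    using norm2_Cauchy_Schwarz[of "\<lambda>i. row i u \<xi>" "\<lambda>i. row i v \<xi>" m] by linarith
  also have "\<dots> \<le> len u \<xi> * len v \<xi>" by (intro mult_mono L) (simp add: less_imp_le)
  finally show ?thesis by (simp add: corr_def)
qed

lemma sum_level_d1_level_d1: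
  "(\<Sum>k\<in>K. sgn_part k * (level_d1 k u \<xi> * level_d1 k v \<xi>)) = (corr u v \<xi> - 1) * lorentz u v"
proof -
  let ?a = "\<lambda>i. if i < m then \<sigma>\<^sup>2 * (row i u \<xi> * row i v \<xi> / (len u \<xi> * len v \<xi>)) else 1"
  have \<sigma>2: "\<sigma>\<^sup>2 = 1" using \<sigma> by (metis one_power2 power2_abs)
  have "(\<Sum>k\<in>K. sgn_part k * (level_d1 k u \<xi> * level_d1 k v \<xi>))
     = (\<Sum>k\<in>K. sgn_part k * (?a (fst k) * (light_lift u (snd k) * light_lift v (snd k))))"
    by (intro sum.cong refl) (auto simp: level_d1_def power2_eq_square)
  also have "\<dots> = ((\<Sum>i<m. ?a i) - ?a m) * lorentz u v" by (rule sum_sgn_part)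
  also have "(\<Sum>i<m. ?a i) = corr u v \<xi>"
    unfolding corr_def sum_divide_distrib using \<sigma>2 by (intro sum.cong) auto
  finally show ?thesis by simp
qed

lemma sum_level_d2: "(\<Sum>k\<in>K. sgn_part k * level_d2 k v \<xi>) = 0"
proof -
  let ?a = "\<lambda>i. if i < m then \<sigma> * (1 / len v \<xi> - (row i v \<xi>)\<^sup>2 / len v \<xi> ^ 3) else 0"
  have "(\<Sum>k\<in>K. sgn_part k * level_d2 k v \<xi>)
     = (\<Sum>k\<in>K. sgn_part k * (?a (fst k) * (light_lift v (snd k) * light_lift v (snd k))))"
    by (intro sum.cong refl) (auto simp: level_d2_def power2_eq_square)
  also have "\<dots> = ((\<Sum>i<m. ?a i) - ?a m) * lorentz v v" by (rule sum_sgn_part)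
  finally show ?thesis by (simp add: lorentz_self)
qed

text \<open>
  The terms of the signed Laplacian that involve a single \<open>v\<close> vanish, because the lift of \<open>v\<close> is on the
  light cone. What is left is a combination with nonnegative coefficients of the numbers
  \<open>(corr u v \<xi> - 1) * lorentz u v\<close>, products of two nonpositive factors.
\<close>

lemma sign: "(\<Sum>k\<in>split_part. D2 k \<xi>) \<le> (\<Sum>k\<in>matrix_part. D2 k \<xi>)"
proof -
  let ?w = "\<lambda>v. weight v \<xi>"
  have D2: "D2 k \<xi> = F \<xi> * (\<beta>\<^sup>2 * (\<Sum>u\<in>V. \<Sum>v\<in>V. ?w u * ?w v * (level_d1 k u \<xi> * level_d1 k v \<xi>))
      + \<beta> * (\<Sum>v\<in>V. ?w v * (level_d2 k v \<xi> - \<beta> * (level_d1 k v \<xi> * level_d1 k v \<xi>))))" for k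
    unfolding D2_def power_mult_distrib power2_eq_square[of "sum _ _"] sum_product
    by (simp add: mult_ac power2_eq_square)
  have sw2: "(\<Sum>k\<in>K. sgn_part k * (\<Sum>u\<in>V. \<Sum>v\<in>V. ?w u * ?w v * (level_d1 k u \<xi> * level_d1 k v \<xi>)))
     = (\<Sum>u\<in>V. \<Sum>v\<in>V. ?w u * ?w v * (\<Sum>k\<in>K. sgn_part k * (level_d1 k u \<xi> * level_d1 k v \<xi>)))"
    unfolding sum_distrib_left
    by (subst sum.swap, intro sum.cong refl, subst sum.swap, intro sum.cong refl) (simp add: mult_ac)
  have sw1: "(\<Sum>k\<in>K. sgn_part k * (\<Sum>v\<in>V. ?w v * (level_d2 k v \<xi> - \<beta> * (level_d1 k v \<xi> * level_d1 k v \<xi>))))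
     = (\<Sum>v\<in>V. ?w v * ((\<Sum>k\<in>K. sgn_part k * level_d2 k v \<xi>) - \<beta> * (\<Sum>k\<in>K. sgn_part k * (level_d1 k v \<xi> * level_d1 k v \<xi>))))"
    unfolding sum_distrib_left sum_subtractf[symmetric]
    by (subst sum.swap, intro sum.cong refl) (simp add: algebra_simps)
  have "(\<Sum>k\<in>matrix_part. D2 k \<xi>) - (\<Sum>k\<in>split_part. D2 k \<xi>) = (\<Sum>k\<in>K. sgn_part k * D2 k \<xi>)"
    by (rule sum_parts)
  also have "\<dots> = F \<xi> * (\<beta>\<^sup>2 * (\<Sum>k\<in>K. sgn_part k * (\<Sum>u\<in>V. \<Sum>v\<in>V. ?w u * ?w v * (level_d1 k u \<xi> * level_d1 k v \<xi>)))
      + \<beta> * (\<Sum>k\<in>K. sgn_part k * (\<Sum>v\<in>V. ?w v * (level_d2 k v \<xi> - \<beta> * (level_d1 k v \<xi> * level_d1 k v \<xi>)))))"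
    unfolding D2 sum_distrib_left[of "F \<xi>"] sum_distrib_left[of "\<beta>\<^sup>2" _ K] sum_distrib_left[of \<beta> _ K] sum.distrib[symmetric]
    by (intro sum.cong refl) (simp add: distrib_left mult.left_commute)
  also have "\<dots> = F \<xi> * (\<beta>\<^sup>2 * (\<Sum>u\<in>V. \<Sum>v\<in>V. ?w u * ?w v * ((corr u v \<xi> - 1) * lorentz u v)))"
    unfolding sw1 sw2 sum_level_d2 sum_level_d1_level_d1 lorentz_self by simp
  also have "0 \<le> \<dots>"
    using F_bounds(1)[of \<xi>] corr_le_1 lorentz_le_0
    by (intro mult_nonneg_nonneg sum_nonneg mult_nonpos_nonpos) (auto simp: weight_def less_imp_le)
  finally show ?thesis by simp
qed

lemma measurable_row: "i \<le> m \<Longrightarrow> row i v \<in> borel_measurable (std_gaussian_on K)"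
  unfolding row_def
  by (intro borel_measurable_sum borel_measurable_times borel_measurable_const std_gaussian_on_component) auto

lemma measurable_len: "len v \<in> borel_measurable (std_gaussian_on K)"
proof -
  have [measurable]: "row i v \<in> borel_measurable (std_gaussian_on K)" if "i \<in> {..<m}" for i
    using that by (intro measurable_row) auto
  show ?thesis unfolding len_def by measurable
qed

lemma measurable_functional:
  "level v \<in> borel_measurable (std_gaussian_on K)"
  "F \<in> borel_measurable (std_gaussian_on K)"
  "k \<in> K \<Longrightarrow> D1 k \<in> borel_measurable (std_gaussian_on K)"
  "k \<in> K \<Longrightarrow> D2 k \<in> borel_measurable (std_gaussian_on K)"
proof -
  note [measurable] = measurable_len
  have [measurable]: "row m v \<in> borel_measurable (std_gaussian_on K)" for v
    by (rule measurable_row) simp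
  show l[measurable]: "level v \<in> borel_measurable (std_gaussian_on K)" for v
    unfolding level_def by measurable
  have w[measurable]: "weight v \<in> borel_measurable (std_gaussian_on K)" for v
    unfolding weight_def by measurable
  show f[measurable]: "F \<in> borel_measurable (std_gaussian_on K)"
    unfolding F_def by measurable
  assume k: "k \<in> K"
  then have [measurable]: "row (fst k) v \<in> borel_measurable (std_gaussian_on K)" for v
    by (intro measurable_row) auto
  have l1[measurable]: "level_d1 k v \<in> borel_measurable (std_gaussian_on K)" for v
    unfolding level_d1_def by measurable
  have l2[measurable]: "level_d2 k v \<in> borel_measurable (std_gaussian_on K)" for v
    unfolding level_d2_def by measurable
  show "D1 k \<in> borel_measurable (std_gaussian_on K)"
    unfolding D1_def by measurable
  show "D2 k \<in> borel_measurable (std_gaussian_on K)"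
    unfolding D2_def by measurable
qed

theorem gordon_functional_comparison:
  "(LINT \<xi>|std_gaussian_on K. F (\<lambda>k. if k \<in> matrix_part then 0 else \<xi> k))
 \<le> (LINT \<xi>|std_gaussian_on K. F (\<lambda>k. if k \<in> split_part then 0 else \<xi> k))"
proof (rule gaussian_interpolation[OF parts F_path D1_coordinate D2_continuous measurable_functional(2-4)])
  show "\<bar>F x\<bar> \<le> 1 + (3 * \<beta>\<^sup>2 + \<beta>)" for x
    using F_bounds[of x] \<beta> by (smt (verit) zero_le_power2)
  show "\<bar>D1 k x\<bar> \<le> 1 + (3 * \<beta>\<^sup>2 + \<beta>)" for k x
    using D1_bound[of k x] by (smt (verit) zero_le_power2)
  show "\<bar>D2 k x\<bar> \<le> 1 + (3 * \<beta>\<^sup>2 + \<beta>)" for k x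
    using D2_bound[of k x] by linarith
qed (auto intro: sign)

end

abbreviation matrix_index :: "nat \<Rightarrow> nat \<Rightarrow> (nat \<times> nat) set" where
  "matrix_index m N \<equiv> {..m} \<times> {..N}"

definition split_level :: "nat \<Rightarrow> nat \<Rightarrow> real \<Rightarrow> (nat \<Rightarrow> real) \<Rightarrow> (nat \<times> nat \<Rightarrow> real) \<Rightarrow> real" where
  "split_level N m \<sigma> v \<xi> = \<sigma> * sqrt (1 + (\<Sum>i<m. (\<xi> (i, N) * norm2 N v)\<^sup>2)) + (\<Sum>j<N. \<xi> (m, j) * v j)"

definition matrix_level :: "nat \<Rightarrow> nat \<Rightarrow> real \<Rightarrow> (nat \<Rightarrow> real) \<Rightarrow> (nat \<times> nat \<Rightarrow> real) \<Rightarrow> real" where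
  "matrix_level N m \<sigma> v \<xi> = \<sigma> * sqrt (1 + (\<Sum>i<m. (\<Sum>j<N. \<xi> (i, j) * v j)\<^sup>2)) + \<xi> (m, N) * norm2 N v"

lemma measurable_levels:
  "split_level N m \<sigma> v \<in> borel_measurable (std_gaussian_on (matrix_index m N))" (is ?A)
  "matrix_level N m \<sigma> v \<in> borel_measurable (std_gaussian_on (matrix_index m N))" (is ?B)
proof -
  let ?P = "std_gaussian_on (matrix_index m N)"
  show ?A unfolding split_level_def
    by (intro borel_measurable_add borel_measurable_times borel_measurable_const borel_measurable_sum
        borel_measurable_power measurable_compose[OF _ borel_measurable_sqrt] std_gaussian_on_component) auto
  show ?B unfolding matrix_level_def
    by (intro borel_measurable_add borel_measurable_times borel_measurable_const borel_measurable_sum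
        borel_measurable_power measurable_compose[OF _ borel_measurable_sqrt] std_gaussian_on_component) auto
qed

text \<open>
  The functional \<open>F\<close> is at least \<open>1 - \<kappa>\<close> where all levels are at least \<open>1\<close>, and at most \<open>\<kappa>\<close> where
  some level is below \<open>- 1\<close>, once \<open>\<beta>\<close> is large in terms of \<open>\<kappa>\<close> and the number of vectors. Comparing the
  means of \<open>F\<close> therefore compares the two probabilities up to \<open>2 \<kappa>\<close>, and \<open>\<kappa>\<close> is arbitrary.
\<close>

lemma gordon_comparison_finite:
  fixes c :: "(nat \<Rightarrow> real) \<Rightarrow> real"
  defines "P \<equiv> \<lambda>N m. std_gaussian_on (matrix_index m N)"
  assumes V: "finite V" "\<And>v. v \<in> V \<Longrightarrow> norm2 N v \<le> 1" and \<sigma>: "\<bar>\<sigma>\<bar> = 1"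
  shows "measure (P N m) {\<xi>\<in>space (P N m). \<forall>v\<in>V. 1 \<le> split_level N m \<sigma> v \<xi> + c v}
       \<le> measure (P N m) {\<xi>\<in>space (P N m). \<forall>v\<in>V. - 1 \<le> matrix_level N m \<sigma> v \<xi> + c v}"
    (is "measure ?P ?E0 \<le> measure ?P ?E1")
proof (rule field_le_epsilon)
  fix e :: real assume e: "0 < e"
  define \<kappa> where "\<kappa> = min (e / 2) (1 / 2)"
  have \<kappa>: "0 < \<kappa>" "\<kappa> < 1" "2 * \<kappa> \<le> e" using e by (auto simp: \<kappa>_def)
  define \<beta> where "\<beta> = ln ((card V + 1) / \<kappa>)"
  have q: "1 < (card V + 1) / \<kappa>" using \<kappa> by (simp add: field_simps add_strict_increasing)
  have \<beta>: "0 < \<beta>" unfolding \<beta>_def using q by (rule ln_gt_zero)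
  have eb: "exp (- \<beta>) = \<kappa> / (card V + 1)"
    using q \<kappa> by (simp add: \<beta>_def exp_minus)
  have eb\<kappa>: "exp (- \<beta>) \<le> \<kappa>" "card V * exp (- \<beta>) \<le> \<kappa>"
    unfolding eb using \<kappa> by (auto simp: field_simps)
  interpret prob_space ?P unfolding P_def by (rule prob_space_std_gaussian_on)
  interpret gordon_functional N m V \<sigma> \<beta> c
    using V \<sigma> \<beta> by unfold_locales auto
  let ?z0 = "\<lambda>\<xi> k. if k \<in> matrix_part then 0 else \<xi> k :: real"
  let ?z1 = "\<lambda>\<xi> k. if k \<in> split_part then 0 else \<xi> k :: real"
  have ext_sum: "row i v \<xi> = (\<Sum>j<N. \<xi> (i, j) * v j) + \<xi> (i, N) * norm2 N v" for i v \<xi>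
  proof -
    have "row i v \<xi> = (\<Sum>j<N. \<xi> (i, j) * light_lift v j) + \<xi> (i, N) * light_lift v N"
      unfolding row_def by (simp add: lessThan_Suc_atMost[symmetric])
    then show ?thesis by (simp add: light_lift_def)
  qed
  \<comment> \<open>\<open>?z0\<close> keeps only \<open>g\<close> and \<open>h\<close>, while \<open>?z1\<close> keeps only \<open>G\<close> and \<open>\<gamma>\<close>\<close>
  have r0: "row i v (?z0 \<xi>) = \<xi> (i, N) * norm2 N v" if "i < m" for i v \<xi>
    using that by (auto simp: ext_sum matrix_part_def)
  have r0m: "row m v (?z0 \<xi>) = (\<Sum>j<N. \<xi> (m, j) * v j)" for v \<xi>
    by (auto simp: ext_sum matrix_part_def)
  have r1: "row i v (?z1 \<xi>) = (\<Sum>j<N. \<xi> (i, j) * v j)" if "i < m" for i v \<xi>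
    using that by (auto simp: ext_sum split_part_def)
  have r1m: "row m v (?z1 \<xi>) = \<xi> (m, N) * norm2 N v" for v \<xi>
    by (auto simp: ext_sum split_part_def)
  have z0_level: "level v (?z0 \<xi>) = split_level N m \<sigma> v \<xi> + c v" for v \<xi>
    unfolding level_def len_def split_level_def r0m using r0 by simp
  have z1_level: "level v (?z1 \<xi>) = matrix_level N m \<sigma> v \<xi> + c v" for v \<xi>
    unfolding level_def len_def matrix_level_def r1m using r1 by simp
  have s: "(\<lambda>\<xi>. F (\<lambda>k. if k \<in> A then 0 else \<xi> k)) \<in> borel_measurable ?P" if "A \<subseteq> K" for A
  proof -
    have "(\<lambda>\<xi> k. (if k \<in> A then 0 else 1) * \<xi> k) \<in> measurable ?P ?P"
      unfolding P_def using that by (intro measurable_scale_std_gaussian_on) auto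
    moreover have "(\<lambda>k. (if k \<in> A then 0 else 1) * \<xi> k) = (\<lambda>k. if k \<in> A then 0 else \<xi> k :: real)" for \<xi>
      by (intro ext) auto
    ultimately show ?thesis
      using measurable_functional(2) unfolding P_def by (auto intro: measurable_compose)
  qed
  have iF: "integrable ?P (\<lambda>\<xi>. F (?z0 \<xi>))" "integrable ?P (\<lambda>\<xi>. F (?z1 \<xi>))"
    unfolding P_def using s[unfolded P_def] parts F_bounds
    by (auto intro!: integrable_bounded[where B=1] simp: abs_of_pos)
  have mE: "?E0 \<in> sets ?P" "?E1 \<in> sets ?P"
  proof -
    have "{\<xi>\<in>space ?P. 1 \<le> split_level N m \<sigma> v \<xi> + c v} \<in> sets ?P" for v
      using measurable_levels(1)[of N m \<sigma> v] unfolding P_def by measurable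
    then show "?E0 \<in> sets ?P" by (intro sets.sets_Collect_finite_All V) auto
    have "{\<xi>\<in>space ?P. - 1 \<le> matrix_level N m \<sigma> v \<xi> + c v} \<in> sets ?P" for v
      using measurable_levels(2)[of N m \<sigma> v] unfolding P_def by measurable
    then show "?E1 \<in> sets ?P" by (intro sets.sets_Collect_finite_All V) auto
  qed
  have lower: "1 - \<kappa> \<le> F \<xi>" if "\<And>v. v \<in> V \<Longrightarrow> 1 \<le> level v \<xi>" for \<xi>
  proof -
    have "(\<Sum>v\<in>V. weight v \<xi>) \<le> (\<Sum>v\<in>V. exp (- \<beta>))"
      using that \<beta> by (intro sum_mono) (auto simp: weight_def)
    then have "(\<Sum>v\<in>V. weight v \<xi>) \<le> \<kappa>" using eb\<kappa> by simp
    then show ?thesis unfolding F_def using exp_ge_add_one_self[of "- (\<Sum>v\<in>V. weight v \<xi>)"] by linarith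
  qed
  have upper: "F \<xi> \<le> \<kappa>" if "v \<in> V" "level v \<xi> < - 1" for v \<xi>
  proof -
    have "\<beta> * 1 \<le> \<beta> * (- level v \<xi>)" using that \<beta> by (intro mult_left_mono) auto
    then have "\<beta> \<le> weight v \<xi>" using exp_ge_add_one_self[of "- \<beta> * level v \<xi>"] unfolding weight_def by linarith
    also have "\<dots> \<le> (\<Sum>v\<in>V. weight v \<xi>)" using that V by (intro member_le_sum) (auto simp: weight_def)
    finally have "F \<xi> \<le> exp (- \<beta>)" unfolding F_def by simp
    then show ?thesis using eb\<kappa> by simp
  qed
  have "(1 - \<kappa>) * measure ?P ?E0 = (LINT \<xi>|?P. (1 - \<kappa>) * indicator ?E0 \<xi>)"
    using mE by (simp add: Int_absorb1 subset_iff)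
  also have "\<dots> \<le> (LINT \<xi>|?P. F (?z0 \<xi>))"
    using mE lower[of "?z0 _"] F_bounds(1) unfolding z0_level
    by (intro integral_mono iF integrable_mult_right integrable_real_indicator)
       (auto simp: indicator_def less_imp_le emeasure_eq_measure)
  also have "\<dots> \<le> (LINT \<xi>|?P. F (?z1 \<xi>))"
    unfolding P_def by (rule gordon_functional_comparison)
  also have "\<dots> \<le> (LINT \<xi>|?P. indicator ?E1 \<xi> + \<kappa>)"
  proof (intro integral_mono iF Bochner_Integration.integrable_add integrable_real_indicator integrable_const mE)
    fix \<xi> assume \<xi>: "\<xi> \<in> space ?P"
    show "F (?z1 \<xi>) \<le> indicator ?E1 \<xi> + \<kappa>"
    proof (cases "\<xi> \<in> ?E1")
      case True
      then show ?thesis using F_bounds(2)[of "?z1 \<xi>"] \<kappa> by simp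
    next
      case False
      then obtain v where "v \<in> V" "level v (?z1 \<xi>) < - 1" using \<xi> unfolding z1_level by (auto simp: not_le)
      then show ?thesis using upper[of v "?z1 \<xi>"] False by simp
    qed
  qed (simp add: emeasure_eq_measure)
  also have "\<dots> = measure ?P ?E1 + \<kappa>"
    using mE by (subst Bochner_Integration.integral_add) (auto simp: Int_absorb1 subset_iff prob_space emeasure_eq_measure)
  finally have "measure ?P ?E0 \<le> measure ?P ?E1 + \<kappa> + \<kappa> * measure ?P ?E0" by (simp add: algebra_simps)
  moreover have "\<kappa> * measure ?P ?E0 \<le> \<kappa> * 1" using \<kappa> by (intro mult_left_mono) auto
  ultimately show "measure ?P ?E0 \<le> measure ?P ?E1 + e" using \<kappa> by linarith
qed

text \<open>
  The bound does not depend on the number of vectors, so it passes to sequences by continuity of the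
  measure along the decreasing events for the first \<open>n\<close> vectors.
\<close>

theorem gordon_comparison:
  fixes c :: "(nat \<Rightarrow> real) \<Rightarrow> real" and d :: "nat \<Rightarrow> nat \<Rightarrow> real"
  defines "P \<equiv> \<lambda>N m. std_gaussian_on (matrix_index m N)"
  assumes d: "\<And>n. norm2 N (d n) \<le> 1" and \<sigma>: "\<bar>\<sigma>\<bar> = 1"
  shows "measure (P N m) {\<xi>\<in>space (P N m). \<forall>n. 1 \<le> split_level N m \<sigma> (d n) \<xi> + c (d n)}
       \<le> measure (P N m) {\<xi>\<in>space (P N m). \<forall>n. - 1 \<le> matrix_level N m \<sigma> (d n) \<xi> + c (d n)}"
    (is "measure ?P ?E0 \<le> measure ?P ?E1")
proof -
  interpret prob_space ?P unfolding P_def by (rule prob_space_std_gaussian_on)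
  have [measurable]: "split_level N m \<sigma> v \<in> borel_measurable ?P" "matrix_level N m \<sigma> v \<in> borel_measurable ?P" for v
    unfolding P_def by (rule measurable_levels)+
  define E where "E n = {\<xi>\<in>space ?P. \<forall>v\<in>d ` {..n}. - 1 \<le> matrix_level N m \<sigma> v \<xi> + c v}" for n
  have "measure ?P ?E0 \<le> measure ?P (E n)" for n
  proof -
    have "measure ?P ?E0 \<le> measure ?P {\<xi>\<in>space ?P. \<forall>v\<in>d ` {..n}. 1 \<le> split_level N m \<sigma> v \<xi> + c v}"
      by (intro finite_measure_mono) auto
    also have "\<dots> \<le> measure ?P (E n)"
      unfolding E_def P_def by (rule gordon_comparison_finite) (use d \<sigma> in auto)
    finally show ?thesis .
  qed
  moreover have "(\<lambda>n. measure ?P (E n)) \<longlonglongrightarrow> measure ?P (\<Inter>n. E n)"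
  proof (rule finite_Lim_measure_decseq)
    show "range E \<subseteq> sets ?P" unfolding E_def by auto
    show "decseq E" unfolding decseq_def E_def by fastforce
  qed
  moreover have "(\<Inter>n. E n) = ?E1" by (auto simp: E_def)
  ultimately show ?thesis by (auto intro: LIMSEQ_le_const)
qed

section \<open>Gaussian matrices as near isometries\<close>

lemma (in prob_space) markov_complement:
  fixes X :: "'a \<Rightarrow> real"
  assumes X: "integrable M X" "\<And>x. 0 \<le> X x" and a: "0 < a"
  shows "1 - expectation X / a \<le> prob {x\<in>space M. X x < a}"
proof -
  have [measurable]: "X \<in> borel_measurable M" using X by auto
  have "prob {x\<in>space M. \<not> X x < a} \<le> expectation X / a"
    using integral_Markov_inequality_measure[OF X(1), of "{}" a] X(2) a by (simp add: not_less)
  moreover have "prob {x\<in>space M. \<not> X x < a} = 1 - prob {x\<in>space M. X x < a}"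
    by (rule prob_neg) measurable
  ultimately show ?thesis by linarith
qed

lemma distr_std_gaussian_on_row:
  assumes "i \<le> m"
  shows "distr (std_gaussian_on (matrix_index m N)) (std_gaussian N) (\<lambda>\<xi>. \<lambda>j\<in>{..<N}. \<xi> (i, j)) = std_gaussian N"
  using distr_PiM_reindex[of "matrix_index m N" "\<lambda>_. std_normal_distribution" "\<lambda>j. (i, j)" "{..<N}"] assms
  by (auto simp: std_gaussian_on_def std_gaussian_def inj_on_def prob_space_std_normal)

lemma
  assumes i: "i \<le> m" and W: "integrable (std_gaussian N) (W :: _ \<Rightarrow> real)"
  shows integrable_row: "integrable (std_gaussian_on (matrix_index m N)) (\<lambda>\<xi>. W (\<lambda>j\<in>{..<N}. \<xi> (i, j)))"
    and integral_row: "(LINT \<xi>|std_gaussian_on (matrix_index m N). W (\<lambda>j\<in>{..<N}. \<xi> (i, j))) = (LINT h|std_gaussian N. W h)"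
proof -
  have m: "(\<lambda>\<xi>. \<lambda>j\<in>{..<N}. \<xi> (i, j)) \<in> measurable (std_gaussian_on (matrix_index m N)) (std_gaussian N)"
    unfolding std_gaussian_on_def std_gaussian_def using i by (intro measurable_restrict measurable_component_singleton) auto
  show "integrable (std_gaussian_on (matrix_index m N)) (\<lambda>\<xi>. W (\<lambda>j\<in>{..<N}. \<xi> (i, j)))"
    using integrable_distr[OF m, of W] W by (simp add: distr_std_gaussian_on_row[OF i])
  show "(LINT \<xi>|std_gaussian_on (matrix_index m N). W (\<lambda>j\<in>{..<N}. \<xi> (i, j))) = (LINT h|std_gaussian N. W h)"
    using integral_distr[OF m borel_measurable_integrable[OF W]] by (simp add: distr_std_gaussian_on_row[OF i])
qed

lemma centered_square_moments:
  defines "a \<equiv> \<lambda>y::real. y\<^sup>2 - 1"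
  shows "integrable std_normal_distribution a" "(LINT y|std_normal_distribution. a y) = 0"
    "integrable std_normal_distribution (\<lambda>y. (a y)\<^sup>2)" "(LINT y|std_normal_distribution. (a y)\<^sup>2) = 2"
proof -
  interpret prob_space std_normal_distribution by (rule prob_space_std_normal)
  have p1: "measure std_normal_distribution UNIV = 1" using prob_space by simp
  have i: "integrable std_normal_distribution (\<lambda>y. y ^ n)" for n by (rule integrable_std_normal_pow)
  show "integrable std_normal_distribution a"
    unfolding a_def by (intro Bochner_Integration.integrable_diff i integrable_const)
  show "(LINT y|std_normal_distribution. a y) = 0"
    unfolding a_def by (subst Bochner_Integration.integral_diff[OF i integrable_const])
      (simp add: std_normal_second_moment p1)
  have sq: "(a y)\<^sup>2 = (y ^ 4 - 2 * y\<^sup>2) + 1" for y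
    by (simp add: a_def power2_eq_square power4_eq_xxxx algebra_simps)
  have j: "integrable std_normal_distribution (\<lambda>y. y ^ 4 - 2 * y\<^sup>2)"
    by (intro Bochner_Integration.integrable_diff integrable_mult_right i)
  show "integrable std_normal_distribution (\<lambda>y. (a y)\<^sup>2)"
    unfolding sq by (intro Bochner_Integration.integrable_add j integrable_const)
  show "(LINT y|std_normal_distribution. (a y)\<^sup>2) = 2"
    unfolding sq Bochner_Integration.integral_add[OF j integrable_const]
      Bochner_Integration.integral_diff[OF i integrable_mult_right[OF i]] integral_mult_right_zero
    by (simp add: std_normal_second_moment std_normal_fourth_moment p1)
qed

text \<open>
  Three events of large probability: \<open>X\<close>, the value of \<open>W\<close> at \<open>h\<close>, is below \<open>10 w\<close>; \<open>Y\<close>, which is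
  \<open>(\<parallel>g\<parallel>\<^sup>2 - m)\<^sup>2\<close>, is below \<open>25 m\<close>, whence \<open>\<bar>\<parallel>g\<parallel> - sqrt m\<bar> \<le> 5\<close>; and \<open>Z = \<gamma>\<^sup>2\<close> is below \<open>16\<close>. The
  first two force all levels on the split side to be at least \<open>1\<close>, for either sign \<open>\<sigma>\<close>. By comparison
  the events \<open>E 1\<close> and \<open>E (- 1)\<close> on the matrix side have probability at least \<open>41/50\<close> each; together with
  the bound on \<open>Z\<close> the three probabilities add up to more than \<open>2\<close>, so some \<open>\<xi>\<close> lies in all three
  events. There \<open>E 1\<close> bounds \<open>\<parallel>G v\<parallel>\<close> from below and \<open>E (- 1)\<close> bounds it from above.
\<close>

theorem gaussian_matrix_near_isometry_seq:
  fixes W :: "(nat \<Rightarrow> real) \<Rightarrow> real" and d :: "nat \<Rightarrow> nat \<Rightarrow> real"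
  assumes m: "0 < m" and W: "integrable (std_gaussian N) W" "\<And>h. 0 \<le> W h"
    and w: "(LINT h|std_gaussian N. W h) = w" "0 < w"
    and d: "\<And>n. norm2 N (d n) \<le> 1" "\<And>n h. \<bar>inner_prod N h (d n)\<bar> \<le> W h"
  shows "\<exists>G. \<forall>n. \<bar>norm2 m (\<lambda>i. inner_prod N (G i) (d n)) - sqrt m * norm2 N (d n)\<bar> \<le> 10 * w + 13"
proof -
  let ?K = "matrix_index m N"
  define P where "P = std_gaussian_on ?K"
  interpret prob_space P unfolding P_def by (rule prob_space_std_gaussian_on)
  define X where "X \<xi> = W (\<lambda>j\<in>{..<N}. \<xi> (m, j))" for \<xi> :: "nat \<times> nat \<Rightarrow> real"
  define Y where "Y \<xi> = (\<Sum>k\<in>(\<lambda>i. (i, N)) ` {..<m}. 1 * ((\<xi> k)\<^sup>2 - 1))\<^sup>2" for \<xi> :: "nat \<times> nat \<Rightarrow> real"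
  define Z where "Z \<xi> = (\<Sum>k\<in>{(m, N)}. 1 * \<xi> k)\<^sup>2" for \<xi> :: "nat \<times> nat \<Rightarrow> real"
  have X: "integrable P X" "expectation X = w"
    unfolding X_def P_def using integrable_row[of m m, OF _ W(1)] integral_row[of m m, OF _ W(1)] w by auto
  have Y: "integrable P Y" "expectation Y = 2 * m"
  proof -
    have J: "(\<lambda>i. (i, N)) ` {..<m} \<subseteq> ?K" by auto
    note Y = second_moment_of_centered_sum[where c="\<lambda>_. 1", OF _ J centered_square_moments(1-3)]
    show "integrable P Y" unfolding Y_def P_def by (rule Y(1)) simp
    have "expectation Y = (\<Sum>k\<in>(\<lambda>i. (i, N)) ` {..<m}. 1\<^sup>2) * (LINT y|std_normal_distribution. (y\<^sup>2 - 1)\<^sup>2)"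
      unfolding Y_def P_def by (rule Y(2)) simp
    then show "expectation Y = 2 * m" unfolding centered_square_moments(4) by (simp add: card_image inj_on_def)
  qed
  have Z: "integrable P Z" "expectation Z = 1"
  proof -
    have J: "{(m, N)} \<subseteq> ?K" by auto
    note i = integrable_std_normal_pow[of 1, unfolded power_one_right] integrable_std_normal_pow[of 2]
    note Z = second_moment_of_centered_sum[where c="\<lambda>_. 1", OF _ J i(1) std_normal_mean i(2)]
    show "integrable P Z" unfolding Z_def P_def by (rule Z(1)) simp
    have "expectation Z = (\<Sum>k\<in>{(m, N)}. 1\<^sup>2) * (LINT y|std_normal_distribution. y\<^sup>2)"
      unfolding Z_def P_def by (rule Z(2)) simp
    then show "expectation Z = 1" unfolding std_normal_second_moment by simp
  qed
  note [measurable] = X(1)[THEN borel_measurable_integrable] Y(1)[THEN borel_measurable_integrable]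
    Z(1)[THEN borel_measurable_integrable]
  have [measurable]: "split_level N m \<sigma> v \<in> borel_measurable P" "matrix_level N m \<sigma> v \<in> borel_measurable P" for v \<sigma>
    unfolding P_def by (rule measurable_levels)+
  have pX: "9 / 10 \<le> prob {\<xi>\<in>space P. X \<xi> < 10 * w}"
    using markov_complement[OF X(1), of "10 * w"] w(2) W(2) X(2) by (simp add: X_def)
  have pY: "23 / 25 \<le> prob {\<xi>\<in>space P. Y \<xi> < 25 * m}"
    using markov_complement[OF Y(1), of "25 * m"] m Y(2) by (simp add: Y_def)
  have pZ: "15 / 16 \<le> prob {\<xi>\<in>space P. Z \<xi> < 16}"
    using markov_complement[OF Z(1), of 16] Z(2) by (simp add: Z_def)
  \<comment> \<open>\<open>7\<close> covers the error \<open>5\<close> of the norm of \<open>g\<close>, the smoothing error \<open>1\<close> and the level \<open>1\<close>\<close>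
  define c where "c \<sigma> v = 10 * w + 7 - \<sigma> * sqrt m * norm2 N v" for \<sigma> v
  define E where "E \<sigma> = {\<xi>\<in>space P. \<forall>n. - 1 \<le> matrix_level N m \<sigma> (d n) \<xi> + c \<sigma> (d n)}" for \<sigma>
  have E[measurable]: "E \<sigma> \<in> events" for \<sigma> unfolding E_def by measurable
  have split: "1 \<le> split_level N m \<sigma> (d n) \<xi> + c \<sigma> (d n)"
    if \<xi>: "X \<xi> < 10 * w" "Y \<xi> < 25 * m" and \<sigma>: "\<sigma> = 1 \<or> \<sigma> = - 1" for \<xi> \<sigma> n
  proof -
    let ?v = "norm2 N (d n)"
    define r where "r = norm2 m (\<lambda>i. \<xi> (i, N))"
    have r0: "0 \<le> r" "0 \<le> ?v" by (auto simp: r_def L2_set_nonneg)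
    have r2: "(\<Sum>i<m. (\<xi> (i, N))\<^sup>2) = r\<^sup>2" by (simp add: r_def L2_set_def sum_nonneg)
    have "Y \<xi> = (r\<^sup>2 - m)\<^sup>2"
      unfolding Y_def r2[symmetric] by (subst sum.reindex) (auto simp: inj_on_def sum_subtractf)
    then have "(r\<^sup>2 - m)\<^sup>2 \<le> (5 * sqrt m)\<^sup>2" using \<xi>(2) by (simp add: power_mult_distrib)
    then have "\<bar>r\<^sup>2 - m\<bar> \<le> 5 * sqrt m" by (subst (asm) abs_le_square_iff[symmetric]) simp
    moreover have "r\<^sup>2 - m = (r - sqrt m) * (r + sqrt m)" by (simp add: algebra_simps power2_eq_square)
    ultimately have "\<bar>r - sqrt m\<bar> * (r + sqrt m) \<le> 5 * sqrt m" using r0 by (simp add: abs_mult)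
    moreover have "\<bar>r - sqrt m\<bar> * sqrt m \<le> \<bar>r - sqrt m\<bar> * (r + sqrt m)" using r0 by (intro mult_left_mono) auto
    ultimately have "\<bar>r - sqrt m\<bar> * sqrt m \<le> 5 * sqrt m" by linarith
    then have "\<bar>r - sqrt m\<bar> \<le> 5" using m by simp
    then have "\<bar>r - sqrt m\<bar> * ?v \<le> 5 * 1" using d(1)[of n] r0 by (intro mult_mono) auto
    then have rv: "\<bar>r * ?v - sqrt m * ?v\<bar> \<le> 5" using r0 by (simp add: abs_mult left_diff_distrib[symmetric])
    have "(\<Sum>i<m. (\<xi> (i, N) * ?v)\<^sup>2) = (r * ?v)\<^sup>2"
      by (simp add: power_mult_distrib r2[symmetric] sum_distrib_right)
    moreover have "r * ?v \<le> sqrt (1 + (r * ?v)\<^sup>2)" by (rule real_le_rsqrt) simp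
    moreover have "sqrt (1 + (r * ?v)\<^sup>2) \<le> 1 + r * ?v"
      using r0 by (intro real_le_lsqrt) (auto simp: power2_sum)
    moreover have "inner_prod N (\<lambda>j\<in>{..<N}. \<xi> (m, j)) (d n) = (\<Sum>j<N. \<xi> (m, j) * d n j)"
      by (intro sum.cong) auto
    then have "\<bar>\<Sum>j<N. \<xi> (m, j) * d n j\<bar> \<le> 10 * w"
      using d(2)[where n=n and h="\<lambda>j\<in>{..<N}. \<xi> (m, j)"] \<xi>(1) by (simp add: X_def)
    ultimately show ?thesis using rv \<sigma> unfolding split_level_def c_def by auto
  qed
  have pE: "41 / 50 \<le> prob (E \<sigma>)" if \<sigma>: "\<sigma> = 1 \<or> \<sigma> = - 1" for \<sigma>
  proof -
    let ?A = "{\<xi>\<in>space P. X \<xi> < 10 * w}" and ?B = "{\<xi>\<in>space P. Y \<xi> < 25 * m}"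
    have "prob ?A + prob ?B - 1 \<le> prob (?A \<inter> ?B)"
      using finite_measure_Union'[of ?A ?B] finite_measure_Diff'[of ?B ?A] prob_le_1[of "?A \<union> ?B"]
      by (simp add: Int_commute)
    also have "\<dots> \<le> prob {\<xi>\<in>space P. \<forall>n. 1 \<le> split_level N m \<sigma> (d n) \<xi> + c \<sigma> (d n)}"
      using split \<sigma> by (intro finite_measure_mono) auto
    also have "\<dots> \<le> prob (E \<sigma>)"
      unfolding E_def P_def by (rule gordon_comparison[OF d(1)]) (use \<sigma> in auto)
    finally show ?thesis using pX pY by linarith
  qed
  have "E 1 \<inter> E (- 1) \<inter> {\<xi>\<in>space P. Z \<xi> < 16} \<noteq> {}"
  proof
    let ?C = "{\<xi>\<in>space P. Z \<xi> < 16}"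
    assume e: "E 1 \<inter> E (- 1) \<inter> ?C = {}"
    have "prob (E 1 \<inter> E (- 1)) + prob ?C = prob (E 1 \<inter> E (- 1) \<union> ?C)"
      using e by (intro finite_measure_Union[symmetric]) auto
    also have "\<dots> \<le> 1" by (rule prob_le_1)
    moreover have "prob (E 1) + prob (E (- 1)) - 1 \<le> prob (E 1 \<inter> E (- 1))"
      using finite_measure_Union'[of "E 1" "E (- 1)"] finite_measure_Diff'[of "E (- 1)" "E 1"] prob_le_1[of "E 1 \<union> E (- 1)"]
      by (simp add: Int_commute)
    ultimately show False using pE[of 1] pE[of "- 1"] pZ by linarith
  qed
  then obtain \<xi> where \<xi>: "\<xi> \<in> E 1" "\<xi> \<in> E (- 1)" "Z \<xi> < 16" by blast
  show ?thesis
  proof (intro exI[of _ "\<lambda>i j. \<xi> (i, j)"] allI)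
    fix n
    let ?v = "norm2 N (d n)"
    define l where "l = norm2 m (\<lambda>i. \<Sum>j<N. \<xi> (i, j) * d n j)"
    have l0: "0 \<le> l" by (simp add: l_def L2_set_nonneg)
    have l2: "(\<Sum>i<m. (\<Sum>j<N. \<xi> (i, j) * d n j)\<^sup>2) = l\<^sup>2" by (simp add: l_def L2_set_def sum_nonneg)
    have "(\<xi> (m, N))\<^sup>2 \<le> 4\<^sup>2" using \<xi>(3) by (simp add: Z_def)
    then have "\<bar>\<xi> (m, N)\<bar> \<le> 4" by (subst (asm) abs_le_square_iff[symmetric]) simp
    then have "\<bar>\<xi> (m, N)\<bar> * ?v \<le> 4 * 1" using d(1)[of n] by (intro mult_mono) (auto simp: L2_set_nonneg)
    then have "\<bar>\<xi> (m, N) * ?v\<bar> \<le> 4" by (simp add: abs_mult L2_set_nonneg)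
    moreover have "l \<le> sqrt (1 + l\<^sup>2)" by (rule real_le_rsqrt) simp
    moreover have "sqrt (1 + l\<^sup>2) \<le> 1 + l" using l0 by (intro real_le_lsqrt) (auto simp: power2_sum)
    moreover have "- 1 \<le> matrix_level N m 1 (d n) \<xi> + c 1 (d n)" "- 1 \<le> matrix_level N m (- 1) (d n) \<xi> + c (- 1) (d n)"
      using \<xi>(1,2) by (auto simp: E_def)
    ultimately show "\<bar>norm2 m (\<lambda>i. \<Sum>j<N. \<xi> (i, j) * d n j) - sqrt m * ?v\<bar> \<le> 10 * w + 13"
      unfolding matrix_level_def c_def l2 l_def[symmetric] by (simp add: abs_le_iff)
  qed
qed

text \<open>
  Both sides are continuous in \<open>v\<close>, so a countable dense subset of \<open>T\<close> suffices.
\<close>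

theorem gaussian_matrix_near_isometry:
  fixes W :: "(nat \<Rightarrow> real) \<Rightarrow> real" and T :: "(nat \<Rightarrow> real) set"
  assumes m: "0 < m" and W: "integrable (std_gaussian N) W" "\<And>h. 0 \<le> W h"
    and w: "(LINT h|std_gaussian N. W h) = w" "0 < w"
    and T: "\<And>v. v \<in> T \<Longrightarrow> norm2 N v \<le> 1" "\<And>v h. v \<in> T \<Longrightarrow> \<bar>inner_prod N h v\<bar> \<le> W h"
  shows "\<exists>G. \<forall>v\<in>T. \<bar>norm2 m (\<lambda>i. inner_prod N (G i) v) - sqrt m * norm2 N v\<bar> \<le> 10 * w + 13"
proof (cases "T = {}")
  case False
  obtain D where D: "countable D" "D \<subseteq> T" "T \<subseteq> closure D" by (rule separable)
  have "D \<noteq> {}" using D(3) False by auto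
  then obtain e :: "nat \<Rightarrow> nat \<Rightarrow> real" where e: "range e = D" using range_from_nat_into[OF _ D(1)] by metis
  then have "e n \<in> T" for n using D(2) by blast
  then obtain G where G: "\<And>n. \<bar>norm2 m (\<lambda>i. inner_prod N (G i) (e n)) - sqrt m * norm2 N (e n)\<bar> \<le> 10 * w + 13"
    using gaussian_matrix_near_isometry_seq[OF m W w, of e] T by blast
  let ?f = "\<lambda>v. \<bar>norm2 m (\<lambda>i. inner_prod N (G i) v) - sqrt m * norm2 N v\<bar>"
  have "continuous_on UNIV ?f"
    unfolding L2_set_def by (intro continuous_intros) (auto intro: continuous_on_product_coordinates)
  then have "closed {v. ?f v \<le> 10 * w + 13}"
    by (intro closed_Collect_le continuous_on_const)
  moreover have "D \<subseteq> {v. ?f v \<le> 10 * w + 13}" using G e by blast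
  ultimately have "T \<subseteq> {v. ?f v \<le> 10 * w + 13}" using D(3) closure_minimal by blast
  then show ?thesis by blast
qed simp

section \<open>Duality for near isometries\<close>

text \<open>
  A Hahn--Banach statement: on the convex cone \<open>C\<close> the coordinate \<open>l\<close> is dominated by \<open>\<parallel>p\<parallel>\<close>, hence by a
  linear functional of \<open>p\<close> of norm at most \<open>1\<close>, up to a small error. The functional is found by nearly
  maximising \<open>l - \<parallel>p\<parallel>\<^sup>2 / 2\<close> over \<open>C\<close>; this is bounded by \<open>1/2\<close> because \<open>l \<le> \<parallel>p\<parallel>\<close>. If \<open>(l0, p0)\<close> is a near
  maximiser, moving from it in the direction \<open>(l, p)\<close> gives \<open>l \<le> \<langle>p0, p\<rangle>\<close> up to a small error, and
  shrinking \<open>(l0, p0)\<close> gives \<open>\<parallel>p0\<parallel>\<^sup>2 \<le> l0 \<le> \<parallel>p0\<parallel>\<close> up to a small error, so that \<open>p0\<close> is nearly in the unit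
  ball.
\<close>

lemma cone_dual_vector_bounded:
  fixes C :: "real \<Rightarrow> (nat \<Rightarrow> real) \<Rightarrow> bool"
  assumes C0: "C 0 (\<lambda>_. 0)"
    and add: "\<And>l p l' p'. C l p \<Longrightarrow> C l' p' \<Longrightarrow> C (l + l') (\<lambda>i. p i + p' i)"
    and scale: "\<And>l p s. C l p \<Longrightarrow> 0 \<le> s \<Longrightarrow> C (s * l) (\<lambda>i. s * p i)"
    and bound: "\<And>l p. C l p \<Longrightarrow> l \<le> norm2 m p"
    and \<eta>: "0 < \<eta>"
  shows "\<exists>u. norm2 m u \<le> 1 \<and> (\<forall>l p. C l p \<longrightarrow> norm2 m p \<le> 1 \<longrightarrow> l \<le> inner_prod m u p + \<eta>)"
proof -
  \<comment> \<open>near maximality up to \<open>e\<^sup>2\<close> and steps of length \<open>e\<close> give errors of order \<open>e\<close>\<close>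
  define e where "e = min 1 (\<eta> / 20)"
  have e: "0 < e" "e \<le> 1" "20 * e \<le> \<eta>" using \<eta> by (auto simp: e_def)
  define H where "H l p = l - (norm2 m p)\<^sup>2 / 2" for l p
  define A where "A = {H l p | l p. C l p}"
  have "a \<le> 1 / 2" if a: "a \<in> A" for a
  proof -
    obtain l p where lp: "a = H l p" "C l p" using a unfolding A_def by blast
    have "0 \<le> (norm2 m p - 1)\<^sup>2" by simp
    then show ?thesis using bound[OF lp(2)] by (simp add: lp(1) H_def power2_diff)
  qed
  then have bdd: "bdd_above A" by (rule bdd_aboveI)
  have "A \<noteq> {}" using C0 by (auto simp: A_def)
  then obtain l0 p0 where C: "C l0 p0" and sup: "Sup A - e\<^sup>2 < H l0 p0"
    using less_cSup_iff[OF _ bdd, of "Sup A - e\<^sup>2"] e by (auto simp: A_def)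
  have max: "H l p \<le> H l0 p0 + e\<^sup>2" if "C l p" for l p
  proof -
    have "H l p \<le> Sup A" using that bdd by (intro cSup_upper) (auto simp: A_def)
    then show ?thesis using sup by simp
  qed
  define r where "r = norm2 m p0"
  have r0: "0 \<le> r" by (simp add: r_def L2_set_nonneg)
  \<comment> \<open>shrink \<open>(l0, p0)\<close> by the factor \<open>1 - e\<close>\<close>
  have r: "r * r * (1 - e / 2) \<le> r + e"
  proof -
    have "H ((1 - e) * l0) (\<lambda>i. (1 - e) * p0 i) \<le> H l0 p0 + e\<^sup>2"
      using e by (intro max scale C) auto
    then have "(1 - e) * l0 - ((1 - e) * r)\<^sup>2 / 2 \<le> l0 - r\<^sup>2 / 2 + e\<^sup>2"
      using e unfolding H_def norm2_scale r_def[symmetric] by simp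
    moreover have "(1 - e) * l0 - ((1 - e) * r)\<^sup>2 / 2 = l0 - r\<^sup>2 / 2 - e * l0 + e * (r * r * (1 - e / 2))"
      by (simp add: power2_eq_square field_simps)
    ultimately have "e * (r * r * (1 - e / 2)) \<le> e * (l0 + e)"
      by (simp add: power2_eq_square distrib_left)
    then have "r * r * (1 - e / 2) \<le> l0 + e" using e by simp
    then show ?thesis using bound[OF C] by (simp add: r_def)
  qed
  have "r * r * (1 / 2) \<le> r * r * (1 - e / 2)" using e r0 by (intro mult_left_mono) auto
  then have rr: "r * r \<le> 2 * r + 2" using r e by linarith
  have r3: "r \<le> 3"
  proof (rule ccontr)
    assume "\<not> r \<le> 3"
    then have "3 * r \<le> r * r" by (intro mult_right_mono) auto
    then show False using rr \<open>\<not> r \<le> 3\<close> by linarith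
  qed
  have r1: "r \<le> 1 + 6 * e"
  proof (rule ccontr)
    assume n: "\<not> r \<le> 1 + 6 * e"
    have "r * r \<le> 3 * 3" using r0 r3 by (intro mult_mono) auto
    then have "e * (r * r) \<le> e * 9" using e by (intro mult_left_mono) auto
    moreover have "r * r * (1 - e / 2) = r * r - e * (r * r) / 2" by (simp add: algebra_simps)
    ultimately have a: "r * r \<le> r + 6 * e" using r e by linarith
    have "(1 + 6 * e) * r < r * r" using n e by (intro mult_strict_right_mono) auto
    moreover have "6 * e * 1 \<le> 6 * e * r" using n e by (intro mult_left_mono) auto
    ultimately show False using a by (simp add: algebra_simps)
  qed
  define k where "k = 1 / (1 + 6 * e)"
  have k: "0 < k" "0 \<le> 1 - k" "1 - k \<le> 6 * e" "k * r \<le> 1"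
    using e r1 mult_nonneg_nonneg[of e e] by (auto simp: k_def field_simps)
  define u where "u = (\<lambda>i. k * p0 i)"
  show ?thesis
  proof (intro exI[of _ u] conjI allI impI)
    show "norm2 m u \<le> 1"
      unfolding u_def norm2_scale r_def[symmetric] using k by simp
    fix l p assume lp: "C l p" "norm2 m p \<le> 1"
    let ?i = "inner_prod m p0 p"
    \<comment> \<open>move from \<open>(l0, p0)\<close> by \<open>e\<close> in the direction \<open>(l, p)\<close>\<close>
    have "H (l0 + e * l) (\<lambda>i. p0 i + e * p i) \<le> H l0 p0 + e\<^sup>2"
      using e lp by (intro max add scale C) auto
    then have "l0 + e * l - ((norm2 m p0)\<^sup>2 + 2 * e * ?i + e\<^sup>2 * (norm2 m p)\<^sup>2) / 2 \<le> l0 - (norm2 m p0)\<^sup>2 / 2 + e\<^sup>2"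
      unfolding H_def norm2_add_sq .
    moreover have "e * (l - ?i) = e * l - e * ?i" "e * (e + e * (norm2 m p)\<^sup>2 / 2) = e\<^sup>2 + e\<^sup>2 * (norm2 m p)\<^sup>2 / 2"
      by (simp_all add: power2_eq_square algebra_simps)
    ultimately have "e * (l - ?i) \<le> e * (e + e * (norm2 m p)\<^sup>2 / 2)"
      unfolding add_divide_distrib by linarith
    then have "l - ?i \<le> e + e * (norm2 m p)\<^sup>2 / 2" using e by simp
    moreover have "e * (norm2 m p)\<^sup>2 \<le> e * 1"
      using e lp(2) by (intro mult_left_mono power_le_one) (auto simp: L2_set_nonneg)
    moreover have "?i - inner_prod m u p \<le> 18 * e"
    proof -
      have "\<bar>?i\<bar> \<le> 3 * 1"
        using norm2_Cauchy_Schwarz[of p0 p m] mult_mono[OF r3 lp(2)] r_def by (auto simp: L2_set_nonneg)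
      then have "(1 - k) * \<bar>?i\<bar> \<le> (6 * e) * 3"
        using e k by (intro mult_mono) auto
      moreover have "(1 - k) * ?i \<le> (1 - k) * \<bar>?i\<bar>" using k by (intro mult_left_mono) auto
      moreover have "inner_prod m u p = k * ?i" unfolding u_def by (rule inner_prod_scale)
      ultimately show ?thesis by (simp add: left_diff_distrib)
    qed
    ultimately show "l \<le> inner_prod m u p + \<eta>" using e by linarith
  qed
qed

lemma cone_dual_vector:
  fixes C :: "real \<Rightarrow> (nat \<Rightarrow> real) \<Rightarrow> bool"
  assumes C0: "C 0 (\<lambda>_. 0)"
    and add: "\<And>l p l' p'. C l p \<Longrightarrow> C l' p' \<Longrightarrow> C (l + l') (\<lambda>i. p i + p' i)"
    and scale: "\<And>l p s. C l p \<Longrightarrow> 0 \<le> s \<Longrightarrow> C (s * l) (\<lambda>i. s * p i)"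
    and bound: "\<And>l p. C l p \<Longrightarrow> l \<le> norm2 m p"
    and \<eta>: "0 < \<eta>"
  shows "\<exists>u. norm2 m u \<le> 1 \<and> (\<forall>l p. C l p \<longrightarrow> l \<le> inner_prod m u p + \<eta> * norm2 m p)"
proof -
  obtain u where u: "norm2 m u \<le> 1" "\<And>l p. C l p \<Longrightarrow> norm2 m p \<le> 1 \<Longrightarrow> l \<le> inner_prod m u p + \<eta>"
    using cone_dual_vector_bounded[where C=C and m=m and \<eta>=\<eta>, OF assms] by blast
  have "l \<le> inner_prod m u p + \<eta> * norm2 m p" if lp: "C l p" for l p
  proof (cases "norm2 m p = 0")
    case True
    then show ?thesis using norm2_Cauchy_Schwarz[of u p m] bound[OF lp] by simp
  next
    case False
    then have n: "0 < norm2 m p" using L2_set_nonneg[of p "{..<m}"] by linarith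
    let ?s = "1 / norm2 m p"
    have "norm2 m (\<lambda>i. ?s * p i) \<le> 1" unfolding norm2_scale using n by simp
    moreover have "C (?s * l) (\<lambda>i. ?s * p i)" using n by (intro scale lp) simp
    ultimately have "?s * l \<le> inner_prod m u (\<lambda>i. ?s * p i) + \<eta>" by (intro u(2))
    then have "?s * l \<le> ?s * inner_prod m u p + \<eta>" unfolding inner_prod_scale .
    then show ?thesis using n by (simp add: field_simps)
  qed
  then show ?thesis using u(1) by blast
qed

text \<open>
  For \<open>t = 1\<close> these \<open>w\<close> form the set called \<open>T\<close> at the beginning; the cone over \<open>T\<close> is closed under
  addition without any normalisation. If \<open>W\<close> is the support function of a symmetric set in the unit
  ball, the cone contains \<open>(t, w)\<close> for every \<open>w\<close> in \<open>t\<close> times the convex hull of that set.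
\<close>

definition width_cone :: "nat \<Rightarrow> ((nat \<Rightarrow> real) \<Rightarrow> real) \<Rightarrow> real \<Rightarrow> (nat \<Rightarrow> real) \<Rightarrow> bool" where
  "width_cone N W t w \<longleftrightarrow> norm2 N w \<le> t \<and> (\<forall>h. \<bar>inner_prod N h w\<bar> \<le> t * W h)"

lemma width_cone_nonneg: "width_cone N W t w \<Longrightarrow> 0 \<le> t"
  unfolding width_cone_def using L2_set_nonneg order_trans by blast

lemma width_cone_add:
  assumes "width_cone N W t w" "width_cone N W t' w'"
  shows "width_cone N W (t + t') (\<lambda>i. w i + w' i)"
  unfolding width_cone_def
proof (intro conjI allI)
  show "norm2 N (\<lambda>i. w i + w' i) \<le> t + t'"
    using assms L2_set_triangle_ineq[of w w' "{..<N}"] by (auto simp: width_cone_def)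
  fix h
  have "\<bar>inner_prod N h w\<bar> \<le> t * W h" "\<bar>inner_prod N h w'\<bar> \<le> t' * W h"
    using assms by (auto simp: width_cone_def)
  then show "\<bar>inner_prod N h (\<lambda>i. w i + w' i)\<bar> \<le> (t + t') * W h"
    unfolding inner_prod_add distrib_right by linarith
qed

lemma width_cone_scale:
  assumes "width_cone N W t w"
  shows "width_cone N W (\<bar>s\<bar> * t) (\<lambda>i. s * w i)"
  using assms unfolding width_cone_def norm2_scale inner_prod_scale abs_mult mult.assoc
  by (auto intro: mult_left_mono)

abbreviation apply_matrix :: "nat \<Rightarrow> (nat \<Rightarrow> nat \<Rightarrow> real) \<Rightarrow> (nat \<Rightarrow> real) \<Rightarrow> nat \<Rightarrow> real" where
  "apply_matrix N A v \<equiv> (\<lambda>i. inner_prod N (A i) v)"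

text \<open>
  The pairs \<open>(\<langle>u, w\<rangle> - \<delta> t, A w)\<close> with \<open>(t, w)\<close> in the width cone form a convex cone, and
  \<open>\<langle>u, w\<rangle> - \<delta> t \<le> \<parallel>w\<parallel> - \<delta> t \<le> \<parallel>A w\<parallel>\<close>. The dual vector of this cone is \<open>u'\<close>. It gives a one-sided estimate,
  which is applied to \<open>w\<close> and \<open>- w\<close>.
\<close>

lemma near_isometry_dual_vector:
  assumes A: "\<And>t w. width_cone N W t w \<Longrightarrow> \<bar>norm2 m (apply_matrix N A w) - norm2 N w\<bar> \<le> \<delta> * t"
    and \<delta>: "0 < \<delta>" "\<delta> \<le> 1" and u: "norm2 N u \<le> 1"
  shows "\<exists>u'. norm2 m u' \<le> 1 \<and>
    (\<forall>t w. width_cone N W t w \<longrightarrow> \<bar>inner_prod N u w - inner_prod m u' (apply_matrix N A w)\<bar> \<le> 2 * \<delta> * t)"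
proof -
  define C where "C l p \<longleftrightarrow> (\<exists>t w. width_cone N W t w \<and> l = inner_prod N u w - \<delta> * t \<and> p = apply_matrix N A w)" for l p
  have CI: "width_cone N W t w \<Longrightarrow> C (inner_prod N u w - \<delta> * t) (apply_matrix N A w)" for t w
    unfolding C_def by blast
  have "\<exists>u'. norm2 m u' \<le> 1 \<and> (\<forall>l p. C l p \<longrightarrow> l \<le> inner_prod m u' p + \<delta> / 2 * norm2 m p)"
  proof (rule cone_dual_vector)
    show "C 0 (\<lambda>_. 0)"
      using CI[of 0 "\<lambda>_. 0"] by (simp add: width_cone_def L2_set_def)
    show "C (l + l') (\<lambda>i. p i + p' i)" if C: "C l p" "C l' p'" for l p l' p'
    proof -
      obtain t w t' w' where w: "width_cone N W t w" "l = inner_prod N u w - \<delta> * t" "p = apply_matrix N A w"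
        and w': "width_cone N W t' w'" "l' = inner_prod N u w' - \<delta> * t'" "p' = apply_matrix N A w'"
        using C unfolding C_def by blast
      show ?thesis
        using CI[OF width_cone_add[OF w(1) w'(1)]] unfolding w w' inner_prod_add by (simp add: algebra_simps)
    qed
    show "C (s * l) (\<lambda>i. s * p i)" if C: "C l p" and s: "0 \<le> s" for l p s
    proof -
      obtain t w where w: "width_cone N W t w" "l = inner_prod N u w - \<delta> * t" "p = apply_matrix N A w"
        using C unfolding C_def by blast
      show ?thesis
        using CI[OF width_cone_scale[OF w(1), of s]] s unfolding w inner_prod_scale by (simp add: algebra_simps)
    qed
    show "l \<le> norm2 m p" if C: "C l p" for l p
    proof -
      obtain t w where w: "width_cone N W t w" "l = inner_prod N u w - \<delta> * t" "p = apply_matrix N A w"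
        using C unfolding C_def by blast
      have "inner_prod N u w \<le> norm2 N u * norm2 N w" using norm2_Cauchy_Schwarz[of u w N] by linarith
      also have "\<dots> \<le> 1 * norm2 N w" by (intro mult_right_mono u) (simp add: L2_set_nonneg)
      finally show ?thesis using A[OF w(1)] unfolding w by simp
    qed
  qed (use \<delta> in simp)
  then obtain u' where u': "norm2 m u' \<le> 1"
    "\<And>l p. C l p \<Longrightarrow> l \<le> inner_prod m u' p + \<delta> / 2 * norm2 m p" by blast
  have half: "inner_prod N u w - inner_prod m u' (apply_matrix N A w) \<le> 2 * \<delta> * t" if w: "width_cone N W t w" for t w
  proof -
    have "norm2 m (apply_matrix N A w) \<le> norm2 N w + \<delta> * t" using A[OF w] by simp
    moreover have "norm2 N w \<le> t" using w by (simp add: width_cone_def)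
    moreover have "\<delta> * t \<le> 1 * t" by (intro mult_right_mono \<delta> width_cone_nonneg[OF w])
    ultimately have "norm2 m (apply_matrix N A w) \<le> 2 * t" by simp
    then have "\<delta> / 2 * norm2 m (apply_matrix N A w) \<le> \<delta> / 2 * (2 * t)" using \<delta> by (intro mult_left_mono) auto
    then show ?thesis using u'(2)[OF CI[OF w]] by simp
  qed
  have "\<bar>inner_prod N u w - inner_prod m u' (apply_matrix N A w)\<bar> \<le> 2 * \<delta> * t" if w: "width_cone N W t w" for t w
  proof -
    have "width_cone N W t (\<lambda>i. - 1 * w i)" using width_cone_scale[OF w, of "- 1"] by simp
    from half[OF this] have "- inner_prod N u w + inner_prod m u' (apply_matrix N A w) \<le> 2 * \<delta> * t"
      unfolding inner_prod_scale by simp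
    then show ?thesis using half[OF w] by linarith
  qed
  then show ?thesis using u'(1) by blast
qed

section \<open>Extension to terminal embeddings\<close>

lemma apply_matrix_diff: "apply_matrix N A (x - y) i = apply_matrix N A x i - apply_matrix N A y i"
  by (simp add: right_diff_distrib sum_subtractf)

lemma sq_diff_bound:
  fixes p t \<delta> :: real
  assumes "\<bar>p - t\<bar> \<le> \<delta> * t" "0 \<le> p" "0 \<le> t" "0 \<le> \<delta>" "\<delta> \<le> 1"
  shows "\<bar>p\<^sup>2 - t\<^sup>2\<bar> \<le> 3 * \<delta> * t\<^sup>2"
proof -
  have "\<delta> * t \<le> 1 * t" using assms by (intro mult_right_mono) auto
  then have "p + t \<le> 3 * t" using assms by linarith
  then have "\<bar>p - t\<bar> * (p + t) \<le> \<delta> * t * (3 * t)" using assms by (intro mult_mono) auto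
  moreover have "p\<^sup>2 - t\<^sup>2 = (p - t) * (p + t)" by (simp add: power2_eq_square algebra_simps)
  ultimately show ?thesis using assms by (simp add: abs_mult power2_eq_square mult_ac)
qed

definition pad :: "nat \<Rightarrow> (nat \<Rightarrow> real) \<Rightarrow> nat \<Rightarrow> real" where
  "pad m p i = (if i < m then p i else 0)"

text \<open>
  With \<open>z = x - x0\<close> and \<open>a u = y - x0\<close>, the squared distances are
  \<open>a\<^sup>2 - 2 a \<langle>u', A z\<rangle> + \<parallel>A z\<parallel>\<^sup>2\<close> in the image and \<open>a\<^sup>2 - 2 a \<langle>u, z\<rangle> + \<parallel>z\<parallel>\<^sup>2\<close> in the source. If \<open>D\<close> is the
  distance of \<open>x\<close> and \<open>y\<close>, the choice of \<open>x0\<close> gives \<open>a \<le> 2 D\<close> and \<open>\<parallel>z\<parallel> \<le> 3 D\<close>, so the inner products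
  contribute at most \<open>24 \<delta> D\<^sup>2\<close> to the difference and the squares at most \<open>27 \<delta> D\<^sup>2\<close>.
\<close>

lemma terminal_point_near:
  assumes A: "\<And>t w. width_cone N W t w \<Longrightarrow> \<bar>norm2 m (apply_matrix N A w) - norm2 N w\<bar> \<le> \<delta> * t"
    and \<delta>: "0 < \<delta>" "\<delta> \<le> 1"
    and X: "\<And>x x'. x \<in> X \<Longrightarrow> x' \<in> X \<Longrightarrow> width_cone N W (norm2 N (x - x')) (x - x')"
    and x0: "x0 \<in> X" "\<And>x. x \<in> X \<Longrightarrow> norm2 N (y - x0) \<le> 2 * norm2 N (y - x)"
  shows "\<exists>p\<in>Rvec (m + 1). \<forall>x\<in>X.
    \<bar>(norm2 (m + 1) (p - pad m (apply_matrix N A x)))\<^sup>2 - (norm2 N (y - x))\<^sup>2\<bar> \<le> 51 * \<delta> * (norm2 N (y - x))\<^sup>2"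
proof -
  define a where "a = norm2 N (y - x0)"
  have a0: "0 \<le> a" by (simp add: a_def L2_set_nonneg)
  \<comment> \<open>if \<open>a = 0\<close> then \<open>1 / a = 0\<close>, and the argument goes through with \<open>u = 0\<close>\<close>
  define u where "u = (\<lambda>i. (1 / a) * (y - x0) i)"
  have u1: "norm2 N u \<le> 1"
    unfolding u_def norm2_scale a_def[symmetric] using a0 by simp
  have au: "inner_prod N (y - x0) z = a * inner_prod N u z" for z
  proof (cases "a = 0")
    case True
    then show ?thesis using norm2_Cauchy_Schwarz[of "y - x0" z N] by (simp add: a_def)
  qed (simp add: u_def sum_distrib_left mult.assoc)
  obtain u' where u': "norm2 m u' \<le> 1"
    "\<And>t w. width_cone N W t w \<Longrightarrow> \<bar>inner_prod N u w - inner_prod m u' (apply_matrix N A w)\<bar> \<le> 2 * \<delta> * t"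
    using near_isometry_dual_vector[OF A \<delta> u1] by blast
  define p where "p = (\<lambda>i. if i < m then apply_matrix N A x0 i + a * u' i
    else if i = m then a * sqrt (1 - (norm2 m u')\<^sup>2) else 0)"
  have p: "p \<in> Rvec (m + 1)" by (auto simp: p_def topspace_Euclidean_space)
  have "\<bar>(norm2 (m + 1) (p - pad m (apply_matrix N A x)))\<^sup>2 - (norm2 N (y - x))\<^sup>2\<bar> \<le> 51 * \<delta> * (norm2 N (y - x))\<^sup>2"
    if x: "x \<in> X" for x
  proof -
    define z where "z = x - x0"
    define t where "t = norm2 N z"
    define D where "D = norm2 N (y - x)"
    let ?q = "apply_matrix N A z"
    have cone: "width_cone N W t z" unfolding t_def z_def by (rule X[OF x x0(1)])
    have t0: "0 \<le> t" and D0: "0 \<le> D" by (auto simp: t_def D_def L2_set_nonneg)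
    have aD: "a \<le> 2 * D" unfolding a_def D_def by (rule x0(2)[OF x])
    have tD: "t \<le> 3 * D"
      using norm2_triangle[of x x0 N y] aD norm2_commute[of x y N] by (simp add: t_def z_def a_def D_def)
    have sq1: "(norm2 m u')\<^sup>2 \<le> 1" using u'(1) by (simp add: power_le_one L2_set_nonneg)
    have zA: "?q i = apply_matrix N A x i - apply_matrix N A x0 i" for i
      unfolding z_def by (rule apply_matrix_diff)
    have P1: "norm2 m (p - pad m (apply_matrix N A x)) = norm2 m (\<lambda>i. a * u' i - ?q i)"
      unfolding zA by (intro norm2_cong) (simp add: p_def pad_def)
    have P2: "(p - pad m (apply_matrix N A x)) m = a * sqrt (1 - (norm2 m u')\<^sup>2)"
      by (simp add: p_def pad_def)
    have n1: "norm2 m (\<lambda>i. a * u' i) = a * norm2 m u'" using norm2_scale[of a u' m] a0 by simp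
    have i1: "inner_prod m (\<lambda>i. a * u' i) ?q = a * inner_prod m u' ?q" by (rule inner_prod_scale)
    have sq2: "(sqrt (1 - (norm2 m u')\<^sup>2))\<^sup>2 = 1 - (norm2 m u')\<^sup>2" using sq1 by simp
    have P: "(norm2 (m + 1) (p - pad m (apply_matrix N A x)))\<^sup>2
      = a\<^sup>2 - 2 * (a * inner_prod m u' ?q) + (norm2 m ?q)\<^sup>2"
      unfolding norm2_Suc_sq P1 P2 norm2_diff_sq n1 i1 power_mult_distrib sq2 by (simp add: right_diff_distrib)
    have "norm2 N (y - x) = norm2 N (\<lambda>i. (y - x0) i - z i)"
      by (intro norm2_cong) (simp add: z_def)
    then have Q: "D\<^sup>2 = a\<^sup>2 - 2 * (a * inner_prod N u z) + t\<^sup>2"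
      by (simp only: norm2_diff_sq au a_def[symmetric] t_def[symmetric] D_def[symmetric])
    have "a * \<bar>inner_prod N u z - inner_prod m u' ?q\<bar> \<le> 2 * D * (2 * \<delta> * (3 * D))"
      using u'(2)[OF cone] aD tD a0 t0 D0 \<delta> by (intro mult_mono order_trans[OF u'(2)[OF cone]]) auto
    then have "\<bar>a * inner_prod N u z - a * inner_prod m u' ?q\<bar> \<le> 12 * \<delta> * D\<^sup>2"
      using a0 by (simp add: abs_mult right_diff_distrib[symmetric] power2_eq_square mult_ac)
    moreover have "\<bar>(norm2 m ?q)\<^sup>2 - t\<^sup>2\<bar> \<le> 3 * \<delta> * t\<^sup>2"
      using A[OF cone] t0 \<delta> by (intro sq_diff_bound) (auto simp: t_def L2_set_nonneg)
    moreover have "3 * \<delta> * t\<^sup>2 \<le> 3 * \<delta> * (3 * D)\<^sup>2" using tD t0 \<delta> by (intro mult_left_mono power_mono) auto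
    moreover have "3 * \<delta> * (3 * D)\<^sup>2 = 27 * (\<delta> * D\<^sup>2)" by (simp add: power_mult_distrib)
    moreover have "12 * \<delta> * D\<^sup>2 = 12 * (\<delta> * D\<^sup>2)" "51 * \<delta> * D\<^sup>2 = 51 * (\<delta> * D\<^sup>2)" by simp_all
    ultimately show ?thesis unfolding D_def[symmetric] P Q by linarith
  qed
  then show ?thesis using p by blast
qed

text \<open>
  If \<open>y\<close> is a limit of points of \<open>X\<close>, then \<open>y - x\<close> is a limit of secants and inherits their distortion.
\<close>

lemma terminal_point_limit:
  assumes A: "\<And>t w. width_cone N W t w \<Longrightarrow> \<bar>norm2 m (apply_matrix N A w) - norm2 N w\<bar> \<le> \<delta> * t"
    and \<delta>: "0 < \<delta>" "\<delta> \<le> 1"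
    and X: "\<And>x x'. x \<in> X \<Longrightarrow> x' \<in> X \<Longrightarrow> width_cone N W (norm2 N (x - x')) (x - x')"
    and s: "\<And>n. s n \<in> X" "(\<lambda>n. norm2 N (y - s n)) \<longlonglongrightarrow> 0" and x: "x \<in> X"
  shows "\<bar>(norm2 m (apply_matrix N A (y - x)))\<^sup>2 - (norm2 N (y - x))\<^sup>2\<bar> \<le> 3 * \<delta> * (norm2 N (y - x))\<^sup>2"
proof (rule sq_diff_bound)
  have c: "(\<lambda>n. s n i) \<longlonglongrightarrow> y i" if "i < N" for i
  proof -
    have "\<bar>y i - s n i\<bar> \<le> norm2 N (y - s n)" for n
      using member_le_L2_set[of "{..<N}" i "\<lambda>i. \<bar>y i - s n i\<bar>"] that by (simp add: L2_set_def)
    then have "(\<lambda>n. y i - s n i) \<longlonglongrightarrow> 0"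
      by (intro Lim_null_comparison[OF _ s(2)]) auto
    from tendsto_diff[OF tendsto_const[of "y i"] this] show ?thesis by simp
  qed
  have l1: "(\<lambda>n. norm2 N (s n - x)) \<longlonglongrightarrow> norm2 N (y - x)"
    unfolding L2_set_def minus_apply by (intro tendsto_intros c) auto
  have l2: "(\<lambda>n. norm2 m (apply_matrix N A (s n - x))) \<longlonglongrightarrow> norm2 m (apply_matrix N A (y - x))"
    unfolding L2_set_def minus_apply by (intro tendsto_intros c) auto
  show "\<bar>norm2 m (apply_matrix N A (y - x)) - norm2 N (y - x)\<bar> \<le> \<delta> * norm2 N (y - x)"
  proof (rule LIMSEQ_le)
    show "(\<lambda>n. \<bar>norm2 m (apply_matrix N A (s n - x)) - norm2 N (s n - x)\<bar>)
      \<longlonglongrightarrow> \<bar>norm2 m (apply_matrix N A (y - x)) - norm2 N (y - x)\<bar>"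
      by (intro tendsto_intros l1 l2)
    show "(\<lambda>n. \<delta> * norm2 N (s n - x)) \<longlonglongrightarrow> \<delta> * norm2 N (y - x)"
      by (intro tendsto_intros l1)
    show "\<exists>M. \<forall>n\<ge>M. \<bar>norm2 m (apply_matrix N A (s n - x)) - norm2 N (s n - x)\<bar> \<le> \<delta> * norm2 N (s n - x)"
      using A[OF X[OF s(1) x]] by blast
  qed
qed (use \<delta> in \<open>auto simp: L2_set_nonneg\<close>)

text \<open>
  If no point of \<open>X\<close> is nearest to \<open>y\<close> up to the factor \<open>2\<close>, repeatedly halving the distance shows
  that \<open>y\<close> is a limit of points of \<open>X\<close>; then \<open>A y\<close> is the right image.
\<close>

lemma terminal_point:
  assumes A: "\<And>t w. width_cone N W t w \<Longrightarrow> \<bar>norm2 m (apply_matrix N A w) - norm2 N w\<bar> \<le> \<delta> * t"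
    and \<delta>: "0 < \<delta>" "\<delta> \<le> 1"
    and X: "\<And>x x'. x \<in> X \<Longrightarrow> x' \<in> X \<Longrightarrow> width_cone N W (norm2 N (x - x')) (x - x')"
    and ne: "X \<noteq> {}"
  shows "\<exists>p\<in>Rvec (m + 1). \<forall>x\<in>X.
    \<bar>(norm2 (m + 1) (p - pad m (apply_matrix N A x)))\<^sup>2 - (norm2 N (y - x))\<^sup>2\<bar> \<le> 51 * \<delta> * (norm2 N (y - x))\<^sup>2"
proof (cases "\<exists>x0\<in>X. \<forall>x\<in>X. norm2 N (y - x0) \<le> 2 * norm2 N (y - x)")
  case True
  then show ?thesis using terminal_point_near[OF A \<delta> X] by blast
next
  case False
  then have "\<forall>x\<in>X. \<exists>x'\<in>X. norm2 N (y - x') \<le> norm2 N (y - x) / 2" by (force simp: not_le)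
  then obtain g where g: "\<And>x. x \<in> X \<Longrightarrow> g x \<in> X \<and> norm2 N (y - g x) \<le> norm2 N (y - x) / 2" by metis
  obtain x1 where x1: "x1 \<in> X" using ne by blast
  define s where "s n = (g ^^ n) x1" for n
  have sX: "s n \<in> X" for n by (induction n) (auto simp: s_def x1 g)
  have sn: "norm2 N (y - s n) \<le> norm2 N (y - x1) * (1 / 2) ^ n" for n
  proof (induction n)
    case (Suc n)
    moreover have "norm2 N (y - s (Suc n)) \<le> norm2 N (y - s n) / 2"
      using g[OF sX[of n]] unfolding s_def funpow.simps comp_apply by blast
    ultimately show ?case unfolding power_Suc by linarith
  qed (simp add: s_def)
  have s0: "(\<lambda>n. norm2 N (y - s n)) \<longlonglongrightarrow> 0"
  proof (rule Lim_null_comparison)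
    show "\<forall>\<^sub>F n in sequentially. norm (norm2 N (y - s n)) \<le> norm2 N (y - x1) * (1 / 2) ^ n"
      using sn by (simp add: L2_set_nonneg)
    show "(\<lambda>n. norm2 N (y - x1) * (1 / 2) ^ n) \<longlonglongrightarrow> 0"
      by (intro tendsto_mult_right_zero LIMSEQ_power_zero) simp
  qed
  show ?thesis
  proof (intro bexI[of _ "pad m (apply_matrix N A y)"] ballI)
    show "pad m (apply_matrix N A y) \<in> Rvec (m + 1)" by (auto simp: pad_def topspace_Euclidean_space)
    fix x assume x: "x \<in> X"
    have "norm2 m (pad m (apply_matrix N A y) - pad m (apply_matrix N A x)) = norm2 m (apply_matrix N A (y - x))"
      by (intro norm2_cong) (simp add: pad_def apply_matrix_diff del: minus_apply, simp add: pad_def)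
    moreover have "(pad m (apply_matrix N A y) - pad m (apply_matrix N A x)) m = 0" by (simp add: pad_def)
    ultimately have "(norm2 (m + 1) (pad m (apply_matrix N A y) - pad m (apply_matrix N A x)))\<^sup>2
      = (norm2 m (apply_matrix N A (y - x)))\<^sup>2" unfolding norm2_Suc_sq by simp
    moreover have "\<bar>(norm2 m (apply_matrix N A (y - x)))\<^sup>2 - (norm2 N (y - x))\<^sup>2\<bar> \<le> 3 * \<delta> * (norm2 N (y - x))\<^sup>2"
      by (rule terminal_point_limit[OF A \<delta> X sX s0 x])
    moreover have "3 * \<delta> * (norm2 N (y - x))\<^sup>2 \<le> 51 * \<delta> * (norm2 N (y - x))\<^sup>2"
      using \<delta> by (intro mult_right_mono) auto
    ultimately show "\<bar>(norm2 (m + 1) (pad m (apply_matrix N A y) - pad m (apply_matrix N A x)))\<^sup>2 - (norm2 N (y - x))\<^sup>2\<bar>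
      \<le> 51 * \<delta> * (norm2 N (y - x))\<^sup>2" by linarith
  qed
qed

text \<open>
  Choosing for each \<open>y\<close> any point \<open>f y\<close> with the stated distances is enough: for \<open>y = x \<in> X\<close> the condition
  at \<open>x\<close> itself forces \<open>f x = A x\<close>.
\<close>

theorem terminal_embedding_of_near_isometry:
  assumes A: "\<And>t w. width_cone N W t w \<Longrightarrow> \<bar>norm2 m (apply_matrix N A w) - norm2 N w\<bar> \<le> \<delta> * t"
    and \<delta>: "0 < \<delta>" "\<delta> \<le> 1" and \<epsilon>: "51 * \<delta> \<le> \<epsilon>" "\<epsilon> < 1"
    and X: "\<And>x x'. x \<in> X \<Longrightarrow> x' \<in> X \<Longrightarrow> width_cone N W (norm2 N (x - x')) (x - x')"
    and ne: "X \<noteq> {}"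
  shows "\<exists>f. f \<in> Rvec N \<rightarrow> Rvec (m + 1) \<and> (\<forall>x\<in>X. \<forall>y\<in>Rvec N.
    (1 - \<epsilon>) * norm2 N (x - y) \<le> norm2 (m + 1) (f x - f y) \<and>
    norm2 (m + 1) (f x - f y) \<le> (1 + \<epsilon>) * norm2 N (x - y))"
proof -
  have "\<forall>y. \<exists>p. p \<in> Rvec (m + 1) \<and> (\<forall>x\<in>X.
    \<bar>(norm2 (m + 1) (p - pad m (apply_matrix N A x)))\<^sup>2 - (norm2 N (y - x))\<^sup>2\<bar> \<le> 51 * \<delta> * (norm2 N (y - x))\<^sup>2)"
    using terminal_point[OF A \<delta> X ne] by blast
  from choice[OF this] obtain f where f0: "\<forall>y. f y \<in> Rvec (m + 1) \<and> (\<forall>x\<in>X.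
    \<bar>(norm2 (m + 1) (f y - pad m (apply_matrix N A x)))\<^sup>2 - (norm2 N (y - x))\<^sup>2\<bar> \<le> 51 * \<delta> * (norm2 N (y - x))\<^sup>2)"
    by (rule exE)
  then have f: "\<And>y. f y \<in> Rvec (m + 1)" "\<And>x y. x \<in> X \<Longrightarrow>
    \<bar>(norm2 (m + 1) (f y - pad m (apply_matrix N A x)))\<^sup>2 - (norm2 N (y - x))\<^sup>2\<bar> \<le> 51 * \<delta> * (norm2 N (y - x))\<^sup>2"
    by blast+
  have z0: "norm2 n (x - x) = 0" for n x by (simp add: L2_set_def)
  have fx: "f x i = pad m (apply_matrix N A x) i" if "x \<in> X" "i < m + 1" for x i
  proof -
    have "norm2 (m + 1) (f x - pad m (apply_matrix N A x)) = 0" using f(2)[OF that(1), of x] by (simp add: z0)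
    then show ?thesis using that(2) by (simp add: L2_set_eq_0_iff)
  qed
  have "(1 - \<epsilon>) * D \<le> P \<and> P \<le> (1 + \<epsilon>) * D" if xy: "x \<in> X" "D = norm2 N (x - y)" "P = norm2 (m + 1) (f x - f y)" for x y D P
  proof -
    have D0: "0 \<le> D" and P0: "0 \<le> P" by (auto simp: xy L2_set_nonneg)
    have e: "0 < \<epsilon>" using \<delta> \<epsilon> by simp
    have "P = norm2 (m + 1) (f y - f x)" unfolding xy by (rule norm2_commute)
    also have "\<dots> = norm2 (m + 1) (f y - pad m (apply_matrix N A x))"
      using fx[OF xy(1)] by (intro norm2_cong) simp
    finally have "\<bar>P\<^sup>2 - D\<^sup>2\<bar> \<le> 51 * \<delta> * D\<^sup>2" using f(2)[OF xy(1), of y] by (simp add: xy(2) norm2_commute[of x y N])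
    also have "\<dots> \<le> \<epsilon> * D\<^sup>2" using \<epsilon> by (intro mult_right_mono) auto
    finally have PD: "(1 - \<epsilon>) * D\<^sup>2 \<le> P\<^sup>2" "P\<^sup>2 \<le> (1 + \<epsilon>) * D\<^sup>2" by (auto simp: algebra_simps abs_le_iff)
    have "((1 - \<epsilon>) * D)\<^sup>2 \<le> P\<^sup>2"
    proof (rule order_trans[OF _ PD(1)])
      have "(1 - \<epsilon>) * (1 - \<epsilon>) \<le> (1 - \<epsilon>) * 1" using e \<epsilon> by (intro mult_left_mono) auto
      then show "((1 - \<epsilon>) * D)\<^sup>2 \<le> (1 - \<epsilon>) * D\<^sup>2"
        unfolding power_mult_distrib by (intro mult_right_mono) (auto simp: power2_eq_square)
    qed
    moreover have "P\<^sup>2 \<le> ((1 + \<epsilon>) * D)\<^sup>2"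
    proof (rule order_trans[OF PD(2)])
      have "(1 + \<epsilon>) * 1 \<le> (1 + \<epsilon>) * (1 + \<epsilon>)" using e by (intro mult_left_mono) auto
      then show "(1 + \<epsilon>) * D\<^sup>2 \<le> ((1 + \<epsilon>) * D)\<^sup>2"
        unfolding power_mult_distrib by (intro mult_right_mono) (auto simp: power2_eq_square)
    qed
    ultimately show ?thesis using P0 D0 e by (auto intro: power2_le_imp_le)
  qed
  then show ?thesis using f(1) by (intro exI[of _ f]) auto
qed

section \<open>The width of the unit secants and the theorem\<close>

definition secants :: "nat \<Rightarrow> (nat \<Rightarrow> real) set \<Rightarrow> (nat \<Rightarrow> real) set" where
  "secants N X = {(\<lambda>i. (x i - y i) / norm2 N (x - y)) | x y. x \<in> X \<and> y \<in> X \<and> x \<noteq> y}"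

text \<open>
  Bounds that are continuous in the secant can thus be checked on \<open>secants\<close>, while the closure is taken
  in the product topology.
\<close>

lemma unit_secants_between_closures:
  assumes "X \<subseteq> Rvec N"
  shows "secants N X \<subseteq> unit_secants N X" "unit_secants N X \<subseteq> closure (secants N X)"
proof -
  have "secants N X \<subseteq> Rvec N"
  proof
    fix v assume "v \<in> secants N X"
    then obtain x y where v: "v = (\<lambda>i. (x i - y i) / norm2 N (x - y))" and xy: "x \<in> Rvec N" "y \<in> Rvec N"
      using assms unfolding secants_def by blast
    show "v \<in> Rvec N" using xy unfolding v topspace_Euclidean_space by simp
  qed
  then show "secants N X \<subseteq> unit_secants N X"
    unfolding unit_secants_def secants_def[symmetric] by (rule closure_of_subset)
  have "unit_secants N X \<subseteq> powertop_real UNIV closure_of secants N X"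
    unfolding unit_secants_def secants_def[symmetric] Euclidean_space_def by (rule closure_of_subtopology_subset)
  then show "unit_secants N X \<subseteq> closure (secants N X)" by (simp add: euclidean_product_topology)
qed

lemma continuous_on_inner_prod: "continuous_on UNIV (\<lambda>v. inner_prod N h v)"
  by (intro continuous_intros) (auto intro: continuous_on_product_coordinates)

lemma continuous_on_norm2: "continuous_on UNIV (\<lambda>v. norm2 N v)"
  unfolding L2_set_def by (intro continuous_intros) (auto intro: continuous_on_product_coordinates)

lemma le_on_closure:
  fixes f :: "(nat \<Rightarrow> real) \<Rightarrow> real"
  assumes "continuous_on UNIV f" "\<And>v. v \<in> R \<Longrightarrow> f v \<le> c" "v \<in> closure R"
  shows "f v \<le> c"
proof -
  have "closed {v. f v \<le> c}" by (intro closed_Collect_le assms continuous_on_const)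
  then have "closure R \<subseteq> {v. f v \<le> c}" by (rule closure_minimal[rotated]) (use assms in auto)
  then show ?thesis using assms by auto
qed

lemma norm2_pos:
  assumes "x \<in> Rvec N" "y \<in> Rvec N" "x \<noteq> y"
  shows "0 < norm2 N (x - y)"
proof -
  obtain i where i: "x i \<noteq> y i" using assms(3) by auto
  have "i < N"
  proof (rule ccontr)
    assume "\<not> i < N"
    then show False using i assms(1,2) by (simp add: topspace_Euclidean_space)
  qed
  then have "norm2 N (x - y) \<noteq> 0" using i by (auto simp: L2_set_eq_0_iff)
  then show ?thesis using L2_set_nonneg[of "x - y" "{..<N}"] by linarith
qed

lemma norm2_secant:
  assumes "x \<in> Rvec N" "y \<in> Rvec N" "x \<noteq> y"
  shows "norm2 N (\<lambda>i. (x i - y i) / norm2 N (x - y)) = 1"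
proof -
  define c where "c = norm2 N (x - y)"
  have "norm2 N (\<lambda>i. (1 / c) * (x - y) i) = \<bar>1 / c\<bar> * c"
    unfolding c_def by (rule norm2_scale)
  then show ?thesis using norm2_pos[OF assms] by (simp add: c_def[symmetric])
qed

locale secant_width =
  fixes N :: nat and X :: "(nat \<Rightarrow> real) set"
  assumes X: "X \<subseteq> Rvec N" and two: "\<exists>x\<in>X. \<exists>y\<in>X. x \<noteq> y"
begin

abbreviation "S \<equiv> unit_secants N X"

definition W :: "(nat \<Rightarrow> real) \<Rightarrow> real" where
  "W h = (SUP a\<in>S. inner_prod N h a)"

lemma S_nonempty: "S \<noteq> {}"
proof -
  have "secants N X \<noteq> {}" using two by (auto simp: secants_def)
  then show ?thesis using unit_secants_between_closures(1)[OF X] by auto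
qed

lemma norm2_S: "s \<in> S \<Longrightarrow> norm2 N s \<le> 1"
proof (rule le_on_closure[OF continuous_on_norm2])
  show "norm2 N v \<le> 1" if "v \<in> secants N X" for v
    using that X norm2_secant unfolding secants_def by fastforce
qed (use unit_secants_between_closures(2)[OF X] in auto)

lemma inner_prod_S_le: "s \<in> S \<Longrightarrow> inner_prod N h s \<le> norm2 N h"
proof -
  assume s: "s \<in> S"
  have "inner_prod N h s \<le> norm2 N h * norm2 N s" using norm2_Cauchy_Schwarz[of h s N] by linarith
  also have "\<dots> \<le> norm2 N h * 1" by (intro mult_left_mono norm2_S s) (simp add: L2_set_nonneg)
  finally show ?thesis by simp
qed

lemma bdd: "bdd_above ((\<lambda>a. inner_prod N h a) ` S)"
  by (rule bdd_aboveI2[where M="norm2 N h"]) (rule inner_prod_S_le)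

lemma le_W: "s \<in> S \<Longrightarrow> inner_prod N h s \<le> W h"
  unfolding W_def by (rule cSUP_upper[OF _ bdd])

text \<open>
  Exchanging the two points of a secant changes its sign, so \<open>S\<close> is symmetric.
\<close>

lemma abs_le_W: "s \<in> S \<Longrightarrow> \<bar>inner_prod N h s\<bar> \<le> W h"
proof -
  assume s: "s \<in> S"
  have "- inner_prod N h s \<le> W h"
  proof (rule le_on_closure[where R="secants N X" and f="\<lambda>v. - inner_prod N h v"])
    show "continuous_on UNIV (\<lambda>v. - inner_prod N h v)" by (intro continuous_on_minus continuous_on_inner_prod)
    show "- inner_prod N h v \<le> W h" if v: "v \<in> secants N X" for v
    proof -
      obtain x y where xy: "v = (\<lambda>i. (x i - y i) / norm2 N (x - y))" "x \<in> X" "y \<in> X" "x \<noteq> y"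
        using v unfolding secants_def by blast
      have "(\<lambda>i. (y i - x i) / norm2 N (y - x)) \<in> secants N X" using xy unfolding secants_def by blast
      then have "(\<lambda>i. (y i - x i) / norm2 N (y - x)) \<in> S" using unit_secants_between_closures(1)[OF X] by blast
      moreover have "(\<lambda>i. (y i - x i) / norm2 N (y - x)) = (\<lambda>i. - 1 * v i)"
        unfolding xy(1) norm2_commute[of y x N] by (auto simp: minus_divide_left)
      ultimately have "inner_prod N h (\<lambda>i. - 1 * v i) \<le> W h" using le_W by metis
      then show ?thesis unfolding inner_prod_scale by simp
    qed
    show "s \<in> closure (secants N X)" using s unit_secants_between_closures(2)[OF X] by blast
  qed
  then show ?thesis using le_W[OF s, of h] by linarith
qed

lemma W_nonneg: "0 \<le> W h"
  using S_nonempty abs_le_W[of _ h] abs_ge_zero order_trans by blast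

lemma W_le: "W h \<le> (\<Sum>i<N. \<bar>h i\<bar>)"
proof -
  have "W h \<le> norm2 N h" unfolding W_def by (intro cSUP_least S_nonempty inner_prod_S_le)
  also have "\<dots> \<le> (\<Sum>i<N. \<bar>h i\<bar>)" by (rule L2_set_le_sum_abs)
  finally show ?thesis .
qed

lemma std_gaussian_eq: "std_gaussian N = std_gaussian_on {..<N}"
  by (simp add: std_gaussian_def std_gaussian_on_def)

lemma measurable_inner_prod: "(\<lambda>h. inner_prod N h s) \<in> borel_measurable (std_gaussian N)"
  unfolding std_gaussian_eq
  by (intro borel_measurable_sum borel_measurable_times borel_measurable_const std_gaussian_on_component)

text \<open>
  The supremum over \<open>S\<close> is a supremum over a countable dense subset.
\<close>

lemma measurable_W: "W \<in> borel_measurable (std_gaussian N)"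
proof -
  obtain D where D: "countable D" "D \<subseteq> S" "S \<subseteq> closure D" by (rule separable)
  have D0: "D \<noteq> {}" using D(3) S_nonempty by auto
  have bD: "bdd_above ((\<lambda>a. inner_prod N h a) ` D)" for h
    using bdd D(2) bdd_above_mono image_mono by metis
  have "W h = (SUP a\<in>D. inner_prod N h a)" for h
  proof (rule antisym)
    show "W h \<le> (SUP a\<in>D. inner_prod N h a)"
      unfolding W_def
    proof (rule cSUP_least[OF S_nonempty])
      fix s assume "s \<in> S"
      then show "inner_prod N h s \<le> (SUP a\<in>D. inner_prod N h a)"
        using D(3) by (intro le_on_closure[OF continuous_on_inner_prod cSUP_upper[OF _ bD]]) blast+
    qed
    show "(SUP a\<in>D. inner_prod N h a) \<le> W h"
      unfolding W_def by (rule cSUP_subset_mono[OF D0 bdd D(2)]) simp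
  qed
  then have "W = (\<lambda>h. SUP a\<in>D. inner_prod N h a)" by (rule ext)
  moreover have "(\<lambda>h. SUP a\<in>D. inner_prod N h a) \<in> borel_measurable (std_gaussian N)"
    by (rule borel_measurable_cSUP[OF D(1) measurable_inner_prod bD])
  ultimately show ?thesis by simp
qed

lemma integrable_W: "integrable (std_gaussian N) W"
proof (rule Bochner_Integration.integrable_bound[where f="\<lambda>h. \<Sum>i<N. \<bar>h i\<bar>"])
  show "integrable (std_gaussian N) (\<lambda>h. \<Sum>i<N. \<bar>h i\<bar>)"
    unfolding std_gaussian_eq
  proof (intro Bochner_Integration.integrable_sum integrable_abs)
    fix k assume k: "k \<in> {..<N}"
    show "integrable (std_gaussian_on {..<N}) (\<lambda>x. x k)"
      by (rule integrable_component[OF k, of "\<lambda>y. y"], rule measurable_ident_sets[OF refl],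
          rule integrable_std_normal_pow[of 1, unfolded power_one_right])
  qed
  show "AE h in std_gaussian N. norm (W h) \<le> norm (\<Sum>i<N. \<bar>h i\<bar>)"
    using W_nonneg W_le by (intro AE_I2) (simp add: sum_nonneg)
qed (rule measurable_W)

lemma gaussian_width_eq: "gaussian_width N S = (LINT h|std_gaussian N. W h)"
  by (simp add: gaussian_width_def W_def)

lemma width_cone_secant:
  assumes "x \<in> X" "y \<in> X"
  shows "width_cone N W (norm2 N (x - y)) (x - y)"
proof (cases "x = y")
  case True
  then show ?thesis by (simp add: width_cone_def L2_set_def)
next
  case False
  have x: "x \<in> Rvec N" "y \<in> Rvec N" using assms X by auto
  define c where "c = norm2 N (x - y)"
  have c: "0 < c" unfolding c_def by (rule norm2_pos[OF x False])
  define s where "s = (\<lambda>i. (x i - y i) / c)"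
  have "s \<in> S"
    using assms False unit_secants_between_closures(1)[OF X] unfolding secants_def s_def c_def by blast
  then have "width_cone N W 1 s" unfolding width_cone_def mult_1 using norm2_S abs_le_W by blast
  from width_cone_scale[OF this, of c] have "width_cone N W c (\<lambda>i. c * s i)" using c by simp
  moreover have "(\<lambda>i. c * s i) = x - y" using c by (intro ext) (simp add: s_def)
  ultimately show ?thesis unfolding c_def by simp
qed

text \<open>
  For a secant \<open>s\<close> of length \<open>1\<close> the variable \<open>Z = \<langle>h, s\<rangle>\<close> has second moment \<open>1\<close>, and \<open>W h \<ge> \<bar>Z\<bar>\<close>. Stein's
  identity gives \<open>E \<bar>Z\<bar> \<ge> E (Z sin Z) = E (cos Z) \<ge> 1 - E Z\<^sup>2 / 2 = 1/2\<close>.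
\<close>

lemma width_ge_half: "1 / 2 \<le> gaussian_width N S"
proof -
  let ?P = "std_gaussian_on {..<N}"
  interpret prob_space ?P by (rule prob_space_std_gaussian_on)
  obtain x y where xy: "x \<in> X" "y \<in> X" "x \<noteq> y" using two by blast
  define s where "s = (\<lambda>i. (x i - y i) / norm2 N (x - y))"
  have sS: "s \<in> S" using xy unit_secants_between_closures(1)[OF X] unfolding secants_def s_def by blast
  have s1: "norm2 N s = 1" unfolding s_def using xy X by (intro norm2_secant) auto
  have ssum: "(\<Sum>k<N. (s k)\<^sup>2) = 1" using norm2_sq[of s N] s1 by simp
  have sk: "\<bar>s k\<bar> \<le> 1" if "k < N" for k
    using member_le_L2_set[of "{..<N}" k "\<lambda>i. \<bar>s i\<bar>"] that s1 by (simp add: L2_set_def)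
  define Z where "Z h = (\<Sum>k<N. s k * h k)" for h :: "nat \<Rightarrow> real"
  have Z_eq: "Z h = inner_prod N h s" for h by (simp add: Z_def mult.commute)
  have mZ: "Z \<in> borel_measurable ?P"
    unfolding Z_def
    by (intro borel_measurable_sum borel_measurable_times borel_measurable_const std_gaussian_on_component)
  have ms: "(\<lambda>h. sin (Z h)) \<in> borel_measurable ?P" "(\<lambda>h. cos (Z h)) \<in> borel_measurable ?P"
    by (rule measurable_compose[OF mZ], simp)+
  have ic: "integrable ?P (\<lambda>h. cos (Z h))"
    by (rule integrable_bounded[OF ms(2), of 1]) simp
  have isn: "integrable ?P (\<lambda>h. h k * sin (Z h))" if "k < N" for k
    using that by (intro integrable_component_mult[where B=1] ms) auto
  have ibp: "expectation (\<lambda>h. h k * sin (Z h)) = s k * expectation (\<lambda>h. cos (Z h))" if k: "k < N" for k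
  proof -
    have dZ: "((\<lambda>t. Z (h(k := t))) has_real_derivative s k) (at t)" for h t
    proof -
      have "((\<lambda>t. Z (h(k := t))) has_real_derivative (\<Sum>l<N. s l * (if l = k then 1 else 0))) (at t)"
        unfolding Z_def by (intro DERIV_sum DERIV_cmult) (auto intro!: derivative_eq_intros)
      moreover have "(\<Sum>l<N. s l * (if l = k then 1 else 0)) = s k"
        using k by (simp add: if_distrib[of "\<lambda>z. _ * z"] cong: if_cong)
      ultimately show ?thesis by metis
    qed
    have "expectation (\<lambda>h. h k * sin (Z h)) = expectation (\<lambda>h. s k * cos (Z h))"
    proof (rule stein_std_gaussian_on[where B=1])
      show "((\<lambda>t. sin (Z (h(k := t)))) has_real_derivative s k * cos (Z (h(k := t)))) (at t)" for h t
        using DERIV_chain2[OF DERIV_sin dZ] by (simp add: mult.commute)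
      show "isCont (\<lambda>t. s k * cos (Z (h(k := t)))) t" for h t
        by (intro continuous_intros DERIV_isCont[OF dZ])
      show "\<bar>s k * cos (Z h)\<bar> \<le> 1" for h
        unfolding abs_mult using sk[OF k] by (intro mult_le_one) auto
    qed (use k ms in \<open>auto intro: borel_measurable_times\<close>)
    then show ?thesis by simp
  qed
  have Z2: "integrable ?P (\<lambda>h. (Z h)\<^sup>2)" "expectation (\<lambda>h. (Z h)\<^sup>2) = 1"
  proof -
    note Z = second_moment_of_centered_sum[of "{..<N}" "{..<N}" "\<lambda>y. y" s, OF _ subset_refl
        integrable_std_normal_pow[of 1, unfolded power_one_right] std_normal_mean integrable_std_normal_pow[of 2]]
    show "integrable ?P (\<lambda>h. (Z h)\<^sup>2)" unfolding Z_def by (rule Z(1)) simp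
    show "expectation (\<lambda>h. (Z h)\<^sup>2) = 1"
      unfolding Z_def by (subst Z(2)) (simp_all add: ssum std_normal_second_moment)
  qed
  have Zs: "(\<lambda>h. Z h * sin (Z h)) = (\<lambda>h. \<Sum>k<N. s k * (h k * sin (Z h)))"
    unfolding Z_def by (simp add: sum_distrib_right mult.assoc)
  have "1 / 2 = expectation (\<lambda>h. 1 - (Z h)\<^sup>2 / 2)"
    using Z2 by (simp add: prob_space)
  also have "\<dots> \<le> expectation (\<lambda>h. cos (Z h))"
  proof (intro integral_mono ic)
    show "1 - (Z h)\<^sup>2 / 2 \<le> cos (Z h)" for h
    proof -
      have "(sin (Z h / 2))\<^sup>2 \<le> (Z h / 2)\<^sup>2"
        using abs_sin_x_le_abs_x[of "Z h / 2"] by (simp only: abs_le_square_iff)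
      then show ?thesis using cos_double_sin[of "Z h / 2"] by (simp add: power_divide)
    qed
  qed (use Z2 in simp)
  also have "\<dots> = (\<Sum>k<N. s k * (s k * expectation (\<lambda>h. cos (Z h))))"
    by (simp add: mult.assoc[symmetric] sum_distrib_right[symmetric] power2_eq_square[symmetric] ssum)
  also have "\<dots> = expectation (\<lambda>h. Z h * sin (Z h))"
    unfolding Zs using isn ibp by (simp add: Bochner_Integration.integral_sum)
  also have "\<dots> \<le> expectation W"
  proof (rule integral_mono)
    show "integrable ?P (\<lambda>h. Z h * sin (Z h))"
      unfolding Zs using isn by (intro Bochner_Integration.integrable_sum integrable_mult_right) auto
    show "integrable ?P W" using integrable_W unfolding std_gaussian_eq .
    fix h
    have "Z h * sin (Z h) \<le> \<bar>Z h\<bar> * \<bar>sin (Z h)\<bar>" by (metis abs_ge_self abs_mult)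
    also have "\<dots> \<le> \<bar>Z h\<bar> * 1" by (intro mult_left_mono abs_sin_le_one) auto
    also have "\<dots> \<le> W h" using abs_le_W[OF sS, of h] by (simp add: Z_eq)
    finally show "Z h * sin (Z h) \<le> W h" .
  qed
  finally show ?thesis unfolding gaussian_width_eq std_gaussian_eq .
qed

text \<open>
  Divide the Gaussian matrix by \<open>sqrt m\<close>. The error \<open>10 w + 13\<close> is at most \<open>36 w\<close> because \<open>w \<ge> 1/2\<close>, and
  homogeneity extends the estimate from \<open>t = 1\<close> to the whole cone.
\<close>

lemma near_isometry_on_width_cone:
  assumes \<delta>: "0 < \<delta>" and m: "(36 * gaussian_width N S / \<delta>)\<^sup>2 \<le> real m"
  shows "\<exists>A. \<forall>t w. width_cone N W t w \<longrightarrow> \<bar>norm2 m (apply_matrix N A w) - norm2 N w\<bar> \<le> \<delta> * t"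
proof -
  let ?w = "gaussian_width N S"
  have w: "1 / 2 \<le> ?w" by (rule width_ge_half)
  have "0 < (36 * ?w / \<delta>)\<^sup>2" using w \<delta> by auto
  then have m0: "0 < m" using m by (metis gr0I leD of_nat_0)
  have rm: "36 * ?w / \<delta> \<le> sqrt m" using m by (rule real_le_rsqrt)
  define T where "T = {v. norm2 N v \<le> 1 \<and> (\<forall>h. \<bar>inner_prod N h v\<bar> \<le> W h)}"
  have "\<exists>G. \<forall>v\<in>T. \<bar>norm2 m (\<lambda>i. inner_prod N (G i) v) - sqrt m * norm2 N v\<bar> \<le> 10 * ?w + 13"
  proof (rule gaussian_matrix_near_isometry[OF m0 integrable_W W_nonneg gaussian_width_eq[symmetric]])
    show "0 < ?w" using w by simp
  qed (unfold T_def, blast+)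
  then obtain G where G: "\<And>v. v \<in> T \<Longrightarrow> \<bar>norm2 m (\<lambda>i. inner_prod N (G i) v) - sqrt m * norm2 N v\<bar> \<le> 10 * ?w + 13"
    by blast
  define A where "A i j = (1 / sqrt m) * G i j" for i j
  have AG: "apply_matrix N A v = (\<lambda>i. (1 / sqrt m) * inner_prod N (G i) v)" for v
    unfolding A_def by (rule ext) (rule inner_prod_scale)
  have AT: "\<bar>norm2 m (apply_matrix N A v) - norm2 N v\<bar> \<le> \<delta>" if v: "v \<in> T" for v
  proof -
    let ?g = "norm2 m (\<lambda>i. inner_prod N (G i) v)"
    have "norm2 m (apply_matrix N A v) - norm2 N v = (1 / sqrt m) * (?g - sqrt m * norm2 N v)"
      unfolding AG norm2_scale using m0 by (simp add: field_simps)
    then have "\<bar>norm2 m (apply_matrix N A v) - norm2 N v\<bar> = (1 / sqrt m) * \<bar>?g - sqrt m * norm2 N v\<bar>"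
      by (simp add: abs_mult)
    also have "\<dots> \<le> (1 / sqrt m) * (36 * ?w)" using G[OF v] w by (intro mult_left_mono) auto
    also have "\<dots> \<le> \<delta>" using rm m0 \<delta> by (simp add: field_simps)
    finally show ?thesis .
  qed
  have "\<bar>norm2 m (apply_matrix N A w) - norm2 N w\<bar> \<le> \<delta> * t" if tw: "width_cone N W t w" for t w
  proof (cases "t = 0")
    case True
    then have "norm2 N w = 0" using tw L2_set_nonneg[of w "{..<N}"] by (auto simp: width_cone_def)
    then have "w j = 0" if "j < N" for j using that by (simp add: L2_set_eq_0_iff)
    then have "norm2 m (apply_matrix N A w) = 0" by (simp add: L2_set_def)
    then show ?thesis using True \<open>norm2 N w = 0\<close> by simp
  next
    case False
    then have t: "0 < t" using width_cone_nonneg[OF tw] by simp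
    have "width_cone N W 1 (\<lambda>i. (1 / t) * w i)" using width_cone_scale[OF tw, of "1 / t"] t by simp
    then have "(\<lambda>i. (1 / t) * w i) \<in> T" by (simp add: T_def width_cone_def)
    from AT[OF this] have "\<bar>(1 / t) * norm2 m (apply_matrix N A w) - (1 / t) * norm2 N w\<bar> \<le> \<delta>"
      unfolding inner_prod_scale norm2_scale using t by simp
    then have "(1 / t) * \<bar>norm2 m (apply_matrix N A w) - norm2 N w\<bar> \<le> \<delta>"
      using t by (simp add: right_diff_distrib[symmetric] abs_mult del: times_divide_eq_left)
    then show ?thesis using t by (simp add: field_simps)
  qed
  then show ?thesis by blast
qed

end

text \<open>
  The two summands of the constant account for \<open>(36 w / \<delta>)\<^sup>2\<close> with \<open>\<delta> = \<epsilon> / 51\<close>, and for the rounding and the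
  additional coordinate, which cost \<open>2 \<le> 8 (w / \<epsilon>)\<^sup>2\<close>.
\<close>

theorem theorem1p1:
  shows "\<exists>C::real. C > 0 \<and>
    (\<forall>(N::nat) (X :: (nat \<Rightarrow> real) set) (\<epsilon>::real).
       X \<subseteq> Rvec N \<longrightarrow> (\<exists>x\<in>X. \<exists>y\<in>X. x \<noteq> y) \<longrightarrow> 0 < \<epsilon> \<longrightarrow> \<epsilon> < 1 \<longrightarrow>
       (\<exists>(m::nat) (f :: (nat \<Rightarrow> real) \<Rightarrow> (nat \<Rightarrow> real)).
          real m \<le> C * \<epsilon> powi (-2) * (gaussian_width N (unit_secants N X))\<^sup>2 \<and>
          f \<in> Rvec N \<rightarrow> Rvec m \<and>
          (\<forall>x\<in>X. \<forall>y\<in>Rvec N.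
             (1 - \<epsilon>) * norm2 N (x - y) \<le> norm2 m (f x - f y) \<and>
             norm2 m (f x - f y) \<le> (1 + \<epsilon>) * norm2 N (x - y))))"
proof (intro exI[of _ "(36 * 51)\<^sup>2 + 8 :: real"] conjI allI impI)
  fix N :: nat and X :: "(nat \<Rightarrow> real) set" and \<epsilon> :: real
  assume X: "X \<subseteq> Rvec N" and two: "\<exists>x\<in>X. \<exists>y\<in>X. x \<noteq> y" and \<epsilon>: "0 < \<epsilon>" "\<epsilon> < 1"
  interpret secant_width N X using X two by unfold_locales
  let ?w = "gaussian_width N (unit_secants N X)"
  define \<delta> where "\<delta> = \<epsilon> / 51"
  have \<delta>: "0 < \<delta>" "\<delta> \<le> 1" using \<epsilon> by (auto simp: \<delta>_def)
  define m where "m = nat \<lceil>(36 * ?w / \<delta>)\<^sup>2\<rceil>"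
  have m: "(36 * ?w / \<delta>)\<^sup>2 \<le> real m" "real m \<le> (36 * ?w / \<delta>)\<^sup>2 + 1"
    unfolding m_def by (rule of_nat_ceiling) (use of_int_ceiling_le_add_one[of "(36 * ?w / \<delta>)\<^sup>2"] in simp)
  obtain A where A: "\<And>t w. width_cone N W t w \<Longrightarrow> \<bar>norm2 m (apply_matrix N A w) - norm2 N w\<bar> \<le> \<delta> * t"
    using near_isometry_on_width_cone[OF \<delta>(1) m(1)] by blast
  have "\<exists>f. f \<in> Rvec N \<rightarrow> Rvec (m + 1) \<and> (\<forall>x\<in>X. \<forall>y\<in>Rvec N.
    (1 - \<epsilon>) * norm2 N (x - y) \<le> norm2 (m + 1) (f x - f y) \<and>
    norm2 (m + 1) (f x - f y) \<le> (1 + \<epsilon>) * norm2 N (x - y))"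
    by (rule terminal_embedding_of_near_isometry[OF A \<delta> _ \<epsilon>(2) width_cone_secant]) (use two in \<open>auto simp: \<delta>_def\<close>)
  then obtain f where f: "f \<in> Rvec N \<rightarrow> Rvec (m + 1)" "\<forall>x\<in>X. \<forall>y\<in>Rvec N.
    (1 - \<epsilon>) * norm2 N (x - y) \<le> norm2 (m + 1) (f x - f y) \<and>
    norm2 (m + 1) (f x - f y) \<le> (1 + \<epsilon>) * norm2 N (x - y)" by blast
  have dim: "real (m + 1) \<le> ((36 * 51)\<^sup>2 + 8) * \<epsilon> powi (-2) * ?w\<^sup>2"
  proof -
    have "\<epsilon> * (1 / 2) \<le> 1 * ?w" using \<epsilon> width_ge_half by (intro mult_mono) auto
    then have "1 / 2 \<le> ?w / \<epsilon>" using \<epsilon> by (simp add: field_simps)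
    then have "(1 / 2)\<^sup>2 \<le> (?w / \<epsilon>)\<^sup>2" by (intro power_mono) auto
    then have "2 \<le> 8 * (?w / \<epsilon>)\<^sup>2" by (simp add: power2_eq_square)
    moreover have "36 * ?w / \<delta> = (36 * 51) * (?w / \<epsilon>)" by (simp add: \<delta>_def)
    then have "real m \<le> (36 * 51)\<^sup>2 * (?w / \<epsilon>)\<^sup>2 + 1" using m(2) by (simp only: power_mult_distrib)
    ultimately have "real (m + 1) \<le> ((36 * 51)\<^sup>2 + 8) * (?w / \<epsilon>)\<^sup>2" by (simp only: distrib_right)
    also have "(?w / \<epsilon>)\<^sup>2 = \<epsilon> powi (-2) * ?w\<^sup>2"
      by (simp add: power_int_minus power_mult_distrib power_inverse divide_inverse mult.commute)
    finally show ?thesis by (simp only: mult.assoc)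
  qed
  show "\<exists>(m::nat) (f :: (nat \<Rightarrow> real) \<Rightarrow> (nat \<Rightarrow> real)).
          real m \<le> ((36 * 51)\<^sup>2 + 8) * \<epsilon> powi (-2) * ?w\<^sup>2 \<and>
          f \<in> Rvec N \<rightarrow> Rvec m \<and>
          (\<forall>x\<in>X. \<forall>y\<in>Rvec N.
             (1 - \<epsilon>) * norm2 N (x - y) \<le> norm2 m (f x - f y) \<and>
             norm2 m (f x - f y) \<le> (1 + \<epsilon>) * norm2 N (x - y))"
    using dim f by blast
qed simp

end
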